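(* Let $c$ be a fixed real number. Then, as $X\to+\infty$, $$\sum_{3\le n\le X}\frac{1}{d_n\,n\,(\log\log n)^c}=\begin{cases}\gamma_c+o(1) & \text{if } c>2,\\ O\left(\log\log\log X\right) & \text{if } c=2,\\ O\left(\dfrac{(\log\log X)^{2-c}}{2-c}\right) & \text{if } c<2,\end{cases}$$ where, for $c>2$, $\gamma_c$ is a (finite) constant depending only on $c$, and the implied constants may depend on $c$ but not on $X$.
   Context: $p_n$ denotes the $n$-th prime number and $d_n=p_{n+1}-p_n$. The result is unconditional. *)

theory Defs
  imports
    Complex_Main
    "HOL-Library.Infinite_Set"
    "HOL-Library.Landau_Symbols"
    "HOL-Computational_Algebra.Primes"
begin

text \<open>
  The primes are numbered from 1, so \<open>nth_prime 1 = 2\<close>, whereas \<^const>\<open>enumerate\<close> counts from 0;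
  the value at 0 is irrelevant.
\<close>

definition nth_prime :: "nat \<Rightarrow> nat" where
  "nth_prime n = enumerate {p. prime p} (n - 1)"

text \<open>
  For \<open>n \<ge> 1\<close> the natural-number subtraction does not truncate, because
  \<^const>\<open>nth_prime\<close> is strictly increasing there.
\<close>

definition prime_gap :: "nat \<Rightarrow> nat" where
  "prime_gap n = nth_prime (n + 1) - nth_prime n"

text \<open>
  The range starts at 3, where \<open>ln (ln n) > 0\<close>; the real power \<open>powr\<close> therefore has a
  positive base.  The upper limit is a real number.
\<close>

definition gap_sum :: "real \<Rightarrow> real \<Rightarrow> real" where
  "gap_sum c X =
     (\<Sum>n | 3 \<le> n \<and> real n \<le> X. 1 / (real (prime_gap n) * real n * ln (ln (real n)) powr c))"

lemma nth_prime_1: "nth_prime 1 = 2"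
  unfolding nth_prime_def
  by (auto simp: enumerate_0 intro!: Least_equality dest: prime_ge_2_nat)

lemma nth_prime_strict_mono: "1 \<le> m \<Longrightarrow> m < n \<Longrightarrow> nth_prime m < nth_prime n"
  unfolding nth_prime_def by (intro enumerate_mono primes_infinite) auto

lemma prime_gap_pos: "1 \<le> n \<Longrightarrow> 0 < prime_gap n"
  using nth_prime_strict_mono[of n "n + 1"] by (simp add: prime_gap_def)

lemma finite_gap_sum_range: "finite {n. 3 \<le> n \<and> real n \<le> X}"
  by (rule finite_subset[of _ "{..nat \<lfloor>X\<rfloor>}"]) (auto simp: le_nat_floor)

end

theory Submission
  imports
    Defs
    "HOL-Number_Theory.Cong"
    "HOL-Computational_Algebra.Squarefree"
    "HOL-Analysis.Harmonic_Numbers"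
    "HOL-Real_Asymp.Real_Asymp"
begin

text \<open>
  On average \<open>d\<^sub>n\<close> has size \<open>ln n\<close>, and the only obstacle to replacing \<open>1 / d\<^sub>n\<close> by \<open>1 / ln n\<close> in an
  upper bound is that too many gaps might be abnormally small.  A sieve rules this out up to a
  factor \<open>ln (ln n)\<close>: for even \<open>d\<close> the number of primes \<open>q < N\<close> with \<open>q + d\<close> also prime is
  \<open>O (\<rho>(d) N / (ln N)\<^sup>2)\<close>, where \<open>\<rho>(d) = d / \<phi>(d)\<close> (\<open>card_prime_pairs_le\<close>), and \<open>\<rho>\<close> is bounded on
  average, so \<open>\<Sum>d\<le>D. \<rho>(d) / d = O(1 + ln D)\<close> (\<open>sum_totient_ratio_div_le\<close>).  Weighting the pairs of
  difference \<open>d \<le> ln M\<close> by \<open>1 / d\<close>, bounding the contribution of the larger gaps by \<open>M / ln M\<close>,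
  and using Chebyshev's \<open>p\<^sub>M = O(M ln M)\<close> (\<open>nth_prime_le\<close>) to pass from primes to their indices
  gives
    \<open>\<Sum>n\<le>M. 1 / d\<^sub>n = O(M ln (ln M) / ln M)\<close>   (\<open>sum_recip_prime_gap_le\<close>).

  On the block \<open>2\<^sup>k \<le> n < 2\<^sup>k\<^sup>+\<^sup>1\<close> the weights \<open>1 / (n (ln (ln n))\<^sup>c)\<close> have constant order of magnitude,
  so the block contributes \<open>O((ln k)\<^sup>1\<^sup>-\<^sup>c / k)\<close> (\<open>dyadic_block_le\<close>).  This is the derivative of
  \<open>(ln x)\<^sup>2\<^sup>-\<^sup>c / (2 - c)\<close>, or of \<open>ln (ln x)\<close> for \<open>c = 2\<close>, and evaluating the antiderivative at
  \<open>x = log 2 X + 1\<close> (\<open>gap_sum_bounds\<close>) yields the three cases.  For \<open>c > 2\<close> the antiderivative is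
  negative, so the partial sums, having nonnegative terms, are bounded and converge.

  The pair bound comes from Selberg's sieve.  Squarefree numbers are represented throughout by
  their sets of prime factors, so that divisibility, gcd and lcm become \<open>\<subseteq>\<close>, \<open>\<inter>\<close> and \<open>\<union>\<close>, and the
  optimisation of the quadratic form (\<open>selberg_weights\<close>) is a statement about finite families of
  finite sets.  Since the sieve level may be taken to be a small power of \<open>N\<close>, very crude bounds
  suffice for the weights and for the remainder.  What needs precision is the sieve density \<open>G\<close>: it
  must be at least of order \<open>(ln y)\<^sup>2 / \<rho>(d)\<close> (\<open>sieve_density_lower_bound\<close>).  This is proved by
  squaring the one-dimensional sum \<open>\<Sum> 1 / m\<close> over squarefree \<open>m \<le> y\<close>.
\<close>

section \<open>Selberg's quadratic form\<close>

lemma prod_one_plus_eq_sum_Pow: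
  fixes f :: "'a \<Rightarrow> real"
  assumes "finite A"
  shows "(\<Prod>x\<in>A. 1 + f x) = (\<Sum>B\<in>Pow A. prod f B)"
proof -
  have "(\<Prod>x\<in>A. f x + 1) = (\<Sum>B\<in>Pow A. prod f B * prod (\<lambda>_. 1) (A - B))"
    using prod_add[OF assms, of f "\<lambda>_. 1"] by simp
  then show ?thesis by (simp add: add.commute)
qed

text \<open>
  This is Moebius inversion on the lattice of finite sets: writing \<open>S = U \<union> B\<close> with \<open>B \<subseteq> T - U\<close>, the
  sum factors as \<open>(1 - 1) ^ card (T - U)\<close>.
\<close>

lemma alternating_sum_interval:
  assumes "finite T"
  shows "(\<Sum>S | U \<subseteq> S \<and> S \<subseteq> T. (-1::real) ^ card S) = (if U = T then (-1) ^ card U else 0)"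
proof (cases "U \<subseteq> T")
  case False
  then have "{S. U \<subseteq> S \<and> S \<subseteq> T} = {}" by auto
  with False show ?thesis by (metis order_refl sum.empty)
next
  case True
  have fU: "finite U" using True assms finite_subset by blast
  have eq: "{S. U \<subseteq> S \<and> S \<subseteq> T} = (\<union>) U ` Pow (T - U)"
  proof (rule set_eqI)
    fix S
    show "S \<in> {S. U \<subseteq> S \<and> S \<subseteq> T} \<longleftrightarrow> S \<in> (\<union>) U ` Pow (T - U)"
    proof
      assume S: "S \<in> {S. U \<subseteq> S \<and> S \<subseteq> T}"
      then have "S = U \<union> (S - U)" "S - U \<in> Pow (T - U)" by auto
      then show "S \<in> (\<union>) U ` Pow (T - U)" by blast
    qed (use True in auto)
  qed
  have inj: "inj_on ((\<union>) U) (Pow (T - U))" by (auto simp: inj_on_def)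
  have "(\<Sum>S | U \<subseteq> S \<and> S \<subseteq> T. (-1::real) ^ card S) = (\<Sum>B\<in>Pow (T - U). (-1) ^ card (U \<union> B))"
    unfolding eq by (simp add: sum.reindex[OF inj])
  also have "\<dots> = (\<Sum>B\<in>Pow (T - U). (-1) ^ card U * (\<Prod>x\<in>B. -1))"
  proof (rule sum.cong)
    fix B assume B: "B \<in> Pow (T - U)"
    then have "finite B" using assms finite_subset by blast
    with B fU have "card (U \<union> B) = card U + card B" by (intro card_Un_disjoint) auto
    then show "(-1::real) ^ card (U \<union> B) = (-1) ^ card U * (\<Prod>x\<in>B. -1)"
      by (simp add: power_add)
  qed simp
  also have "\<dots> = (-1) ^ card U * (\<Prod>x\<in>T - U. 1 + (-1))"
    using assms by (subst prod_one_plus_eq_sum_Pow) (auto simp: sum_distrib_left)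
  also have "\<dots> = (if U = T then (-1) ^ card U else 0)"
    using True assms by (auto simp: card_eq_0_iff power_0_left)
  finally show ?thesis .
qed

text \<open>
  With \<open>g\<close> extended multiplicatively to sets, \<open>prod g (S \<union> T) = prod g S * prod g T / prod g (S \<inter> T)\<close>,
  and \<open>1 / g = 1 + 1 / h\<close> expands the denominator as a sum of \<open>1 / prod h U\<close> over \<open>U \<subseteq> S \<inter> T\<close>.  In the
  variables \<open>v U = \<Sum>S \<supseteq> U. l S * prod g S\<close> the quadratic form is therefore the diagonal form
  \<open>\<Sum>U. (v U)\<^sup>2 / prod h U\<close>, whose minimum under the constraint \<open>l {} = 1\<close> is attained at
  \<open>v U = (-1) ^ card U * prod h U / G\<close>; the weights below are the Moebius inversion of this choice.
  The size bound on \<open>l\<close> is weaker than the familiar \<open>\<bar>l S\<bar> \<le> 1\<close>, but it holds because the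
  defining sum is part of the sum \<open>G\<close>.
\<close>

lemma selberg_weights:
  fixes g :: "'a \<Rightarrow> real"
  assumes fin: "finite \<S>" and finS: "\<And>S. S \<in> \<S> \<Longrightarrow> finite S"
    and empty: "{} \<in> \<S>"
    and down: "\<And>S T. T \<in> \<S> \<Longrightarrow> S \<subseteq> T \<Longrightarrow> S \<in> \<S>"
    and g: "\<And>S x. S \<in> \<S> \<Longrightarrow> x \<in> S \<Longrightarrow> 0 < g x \<and> g x < 1"
  defines "h \<equiv> (\<lambda>x. g x / (1 - g x))"
  defines "G \<equiv> (\<Sum>S\<in>\<S>. prod h S)"
  shows "\<exists>l :: 'a set \<Rightarrow> real. l {} = 1 \<and> (\<forall>S\<in>\<S>. \<bar>l S\<bar> * prod g S \<le> 1) \<and>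
    (\<Sum>S\<in>\<S>. \<Sum>T\<in>\<S>. l S * l T * prod g (S \<union> T)) = 1 / G"
proof -
  have hpos: "0 < prod h S" if "S \<in> \<S>" for S
    using g[OF that] by (intro prod_pos) (auto simp: h_def)
  have gpos: "0 < prod g S" if "S \<in> \<S>" for S
    using g[OF that] by (intro prod_pos) auto
  have G: "G > 0" unfolding G_def by (intro sum_pos fin hpos) (use empty in auto)
  define l where "l S = (-1) ^ card S * (\<Sum>T | T \<in> \<S> \<and> S \<subseteq> T. prod h T) / (prod g S * G)" for S
  have "l {} = 1" using G by (simp add: l_def G_def)
  moreover have "\<bar>l S\<bar> * prod g S \<le> 1" if S: "S \<in> \<S>" for S
  proof -
    have "(\<Sum>T | T \<in> \<S> \<and> S \<subseteq> T. prod h T) \<le> G"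
      unfolding G_def using fin hpos by (intro sum_mono2) (auto intro: less_imp_le)
    moreover have "0 \<le> (\<Sum>T | T \<in> \<S> \<and> S \<subseteq> T. prod h T)"
      using hpos by (intro sum_nonneg) (auto intro: less_imp_le)
    moreover have "\<bar>l S\<bar> * prod g S = (\<Sum>T | T \<in> \<S> \<and> S \<subseteq> T. prod h T) / G"
      using gpos[OF S] G calculation(2) by (simp add: l_def abs_mult)
    ultimately show ?thesis using G by simp
  qed
  moreover have "(\<Sum>S\<in>\<S>. \<Sum>T\<in>\<S>. l S * l T * prod g (S \<union> T)) = 1 / G"
  proof -
    \<comment> \<open>Both conditions on U appear as separate factors, so that the double sum over S and T factors.\<close>
    have split: "prod g (S \<union> T) =
        (\<Sum>U\<in>\<S>. (if U \<subseteq> S then prod g S else 0) * (if U \<subseteq> T then prod g T else 0) / prod h U)"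
      if S: "S \<in> \<S>" and T: "T \<in> \<S>" for S T
    proof -
      have ST: "S \<inter> T \<in> \<S>" using down[OF S] by auto
      have "prod g (S \<union> T) * prod g (S \<inter> T) = prod g S * prod g T"
        by (rule prod.union_inter[OF finS[OF S] finS[OF T]])
      then have "prod g (S \<union> T) = prod g S * prod g T * (1 / prod g (S \<inter> T))"
        using gpos[OF ST] by (simp add: field_simps)
      also have "1 / prod g (S \<inter> T) = (\<Prod>x\<in>S \<inter> T. 1 / g x)" by (simp add: prod_dividef)
      also have "\<dots> = (\<Prod>x\<in>S \<inter> T. 1 + 1 / h x)"
      proof (rule prod.cong)
        fix x assume "x \<in> S \<inter> T"
        then have "0 < g x" "g x < 1" using g[OF S] by auto
        then show "1 / g x = 1 + 1 / h x" by (simp add: h_def field_simps)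
      qed simp
      also have "\<dots> = (\<Sum>U\<in>Pow (S \<inter> T). 1 / prod h U)"
        using finS[OF S] by (subst prod_one_plus_eq_sum_Pow) (auto simp: prod_dividef)
      also have "\<dots> = (\<Sum>U\<in>\<S>. if U \<subseteq> S \<and> U \<subseteq> T then 1 / prod h U else 0)"
        using down[OF ST] fin by (intro sum.mono_neutral_cong_left) auto
      finally show ?thesis by (auto simp: sum_distrib_left intro!: sum.cong)
    qed
    \<comment> \<open>The optimal values of the diagonal variables.\<close>
    have inner: "(\<Sum>S\<in>\<S>. l S * (if U \<subseteq> S then prod g S else 0)) = (-1) ^ card U * prod h U / G"
      if U: "U \<in> \<S>" for U
    proof -
      have "(\<Sum>S\<in>\<S>. l S * (if U \<subseteq> S then prod g S else 0)) =
          (\<Sum>S\<in>\<S>. \<Sum>T\<in>\<S>. if U \<subseteq> S \<and> S \<subseteq> T then (-1) ^ card S * (prod h T / G) else 0)"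
      proof (rule sum.cong)
        fix S assume S: "S \<in> \<S>"
        have "l S * prod g S = (-1) ^ card S * (\<Sum>T | T \<in> \<S> \<and> S \<subseteq> T. prod h T) / G"
          using gpos[OF S] by (simp add: l_def)
        also have "\<dots> = (\<Sum>T | T \<in> \<S> \<and> S \<subseteq> T. (-1) ^ card S * (prod h T / G))"
          by (simp add: sum_distrib_left sum_divide_distrib)
        also have "\<dots> = (\<Sum>T\<in>\<S>. if S \<subseteq> T then (-1) ^ card S * (prod h T / G) else 0)"
          using fin by (intro sum.mono_neutral_cong_left) auto
        finally show "l S * (if U \<subseteq> S then prod g S else 0) =
          (\<Sum>T\<in>\<S>. if U \<subseteq> S \<and> S \<subseteq> T then (-1) ^ card S * (prod h T / G) else 0)" by auto
      qed simp
      also have "\<dots> = (\<Sum>T\<in>\<S>. \<Sum>S\<in>\<S>. if U \<subseteq> S \<and> S \<subseteq> T then (-1) ^ card S * (prod h T / G) else 0)"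
        by (rule sum.swap)
      also have "\<dots> = (\<Sum>T\<in>\<S>. (if U = T then (-1) ^ card U else 0) * (prod h T / G))"
      proof (rule sum.cong)
        fix T assume T: "T \<in> \<S>"
        have "(\<Sum>S\<in>\<S>. if U \<subseteq> S \<and> S \<subseteq> T then (-1) ^ card S * (prod h T / G) else 0) =
          (\<Sum>S | U \<subseteq> S \<and> S \<subseteq> T. (-1) ^ card S * (prod h T / G))"
          using down[OF T] fin by (intro sum.mono_neutral_cong_right) auto
        also have "\<dots> = (\<Sum>S | U \<subseteq> S \<and> S \<subseteq> T. (-1) ^ card S) * (prod h T / G)"
          by (simp only: sum_distrib_right)
        finally show "(\<Sum>S\<in>\<S>. if U \<subseteq> S \<and> S \<subseteq> T then (-1) ^ card S * (prod h T / G) else 0) =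
          (if U = T then (-1) ^ card U else 0) * (prod h T / G)"
          unfolding alternating_sum_interval[OF finS[OF T]] .
      qed simp
      also have "\<dots> = (\<Sum>T\<in>\<S>. if U = T then (-1) ^ card U * (prod h T / G) else 0)"
        by (rule sum.cong) auto
      also have "\<dots> = (-1) ^ card U * prod h U / G" using fin U by simp
      finally show ?thesis .
    qed
    have "(\<Sum>S\<in>\<S>. \<Sum>T\<in>\<S>. l S * l T * prod g (S \<union> T)) =
      (\<Sum>S\<in>\<S>. \<Sum>T\<in>\<S>. \<Sum>U\<in>\<S>. (l S * (if U \<subseteq> S then prod g S else 0)) *
         (l T * (if U \<subseteq> T then prod g T else 0)) / prod h U)"
      by (intro sum.cong) (auto simp: split sum_distrib_left intro!: sum.cong)
    also have "\<dots> = (\<Sum>S\<in>\<S>. \<Sum>U\<in>\<S>. \<Sum>T\<in>\<S>. (l S * (if U \<subseteq> S then prod g S else 0)) *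
         (l T * (if U \<subseteq> T then prod g T else 0)) / prod h U)"
      by (intro sum.cong sum.swap) simp
    also have "\<dots> = (\<Sum>U\<in>\<S>. \<Sum>S\<in>\<S>. \<Sum>T\<in>\<S>. (l S * (if U \<subseteq> S then prod g S else 0)) *
         (l T * (if U \<subseteq> T then prod g T else 0)) / prod h U)"
      by (rule sum.swap)
    also have "\<dots> = (\<Sum>U\<in>\<S>. (\<Sum>S\<in>\<S>. l S * (if U \<subseteq> S then prod g S else 0)) *
         (\<Sum>T\<in>\<S>. l T * (if U \<subseteq> T then prod g T else 0)) / prod h U)"
      by (simp only: sum_product sum_divide_distrib)
    also have "\<dots> = (\<Sum>U\<in>\<S>. prod h U / G ^ 2)"
    proof (rule sum.cong)
      fix U assume U: "U \<in> \<S>"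
      have "((-1::real) ^ card U) * (-1) ^ card U = 1"
        by (metis power_mult_distrib minus_mult_minus mult_1 power_one)
      then have "((-1) ^ card U * prod h U / G) * ((-1) ^ card U * prod h U / G) / prod h U = prod h U / G ^ 2"
        using hpos[OF U] G by (simp add: field_simps power2_eq_square)
      then show "(\<Sum>S\<in>\<S>. l S * (if U \<subseteq> S then prod g S else 0)) *
         (\<Sum>T\<in>\<S>. l T * (if U \<subseteq> T then prod g T else 0)) / prod h U = prod h U / G ^ 2"
        by (simp only: inner[OF U])
    qed simp
    also have "\<dots> = 1 / G"
      using G by (simp add: sum_divide_distrib[symmetric] G_def[symmetric] power2_eq_square)
    finally show ?thesis .
  qed
  ultimately show ?thesis by blast
qed

section \<open>Counting integers in prescribed residue classes\<close>

lemma card_residue_system: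
  fixes \<Omega> :: "nat \<Rightarrow> nat set"
  assumes "finite S" "\<And>p. p \<in> S \<Longrightarrow> prime p" "\<And>p. p \<in> S \<Longrightarrow> \<Omega> p \<subseteq> {..<p}"
  shows "card {n. n < \<Prod>S \<and> (\<forall>p\<in>S. n mod p \<in> \<Omega> p)} = (\<Prod>p\<in>S. card (\<Omega> p))"
  using assms
proof (induction rule: finite_induct)
  case empty
  have "{n::nat. n = 0} = {0}" by auto
  then show ?case by simp
next
  case (insert p S)
  let ?R = "{n. n < \<Prod>S \<and> (\<forall>q\<in>S. n mod q \<in> \<Omega> q)}"
  let ?R' = "{n. n < \<Prod>(insert p S) \<and> (\<forall>q\<in>insert p S. n mod q \<in> \<Omega> q)}"
  have P: "\<Prod>(insert p S) = p * \<Prod>S" using insert by simp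
  have cop: "coprime p (\<Prod>S)"
  proof (rule prod_coprime_right)
    fix q assume "q \<in> S"
    then show "coprime p q" using insert by (intro primes_coprime) auto
  qed
  have pos: "p > 0" using insert.prems by (simp add: prime_gt_0_nat)
  have posS: "\<Prod>S > 0" by (rule prod_pos) (use insert.prems in \<open>simp add: prime_gt_0_nat\<close>)
  have modS: "n mod \<Prod>S mod q = n mod q" if "q \<in> S" for n q
    using that insert.hyps by (intro mod_mod_cancel dvd_prodI) auto
  have "bij_betw (\<lambda>n. (n mod p, n mod \<Prod>S)) ?R' (\<Omega> p \<times> ?R)"
  proof (intro bij_betwI')
    fix n m assume n: "n \<in> ?R'" and m: "m \<in> ?R'"
    show "((n mod p, n mod \<Prod>S) = (m mod p, m mod \<Prod>S)) = (n = m)"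
    proof
      assume "(n mod p, n mod \<Prod>S) = (m mod p, m mod \<Prod>S)"
      then have "[n = m] (mod p * \<Prod>S)"
        by (intro coprime_cong_mult_nat cop) (auto simp: unique_euclidean_semiring_class.cong_def)
      then show "n = m" using n m unfolding P by (simp add: unique_euclidean_semiring_class.cong_def)
    qed auto
  next
    fix n assume "n \<in> ?R'"
    then show "(n mod p, n mod \<Prod>S) \<in> \<Omega> p \<times> ?R" using pos posS by (auto simp: modS)
  next
    fix y assume y: "y \<in> \<Omega> p \<times> ?R"
    obtain a b where ab: "y = (a, b)" by force
    have a: "a < p" "a \<in> \<Omega> p" and b: "b \<in> ?R" using y ab insert.prems(2)[of p] by auto
    obtain x where x: "x < p * \<Prod>S" "[x = a] (mod p)" "[x = b] (mod \<Prod>S)"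
      using binary_chinese_remainder_unique_nat[OF cop, of a b] pos posS by blast
    have xa: "x mod p = a" and xb: "x mod \<Prod>S = b" using x a b by (auto simp: unique_euclidean_semiring_class.cong_def)
    have "x \<in> ?R'" using x(1) xa xb a b modS[of _ x] unfolding P by auto
    then show "\<exists>x\<in>?R'. y = (x mod p, x mod \<Prod>S)" using xa xb ab by auto
  qed
  then have "card ?R' = card (\<Omega> p \<times> ?R)" by (rule bij_betw_same_card)
  also have "\<dots> = card (\<Omega> p) * (\<Prod>p\<in>S. card (\<Omega> p))"
    using insert by (simp add: card_cartesian_product)
  finally show ?case using insert.hyps by simp
qed

lemma card_periodic_bounds:
  fixes P N :: nat
  assumes "P > 0" and per: "\<And>n. Q (n mod P) \<longleftrightarrow> Q n"
  defines "r \<equiv> card {n. n < P \<and> Q n}"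
  shows "\<bar>real (card {n. n < N \<and> Q n}) - real N * real r / real P\<bar> \<le> real r"
proof -
  have shift: "Q (q * P + m) \<longleftrightarrow> Q m" for q m
    using per[of m] per[of "q * P + m"] by simp
  have block: "card {n. n < q * P \<and> Q n} = q * r" for q
  proof (induction q)
    case (Suc q)
    have eq: "{n. n < Suc q * P \<and> Q n} = {n. n < q * P \<and> Q n} \<union> (\<lambda>n. q * P + n) ` {n. n < P \<and> Q n}"
      (is "?L = ?A \<union> ?B")
    proof (intro equalityI subsetI)
      fix n assume n: "n \<in> ?L"
      show "n \<in> ?A \<union> ?B"
      proof (cases "n < q * P")
        case False
        then have "n = q * P + (n - q * P)" "n - q * P < P" using n by auto
        moreover have "Q (n - q * P)" using n shift[of q "n - q * P"] False by simp
        ultimately show ?thesis by blast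
      qed (use n in simp)
    qed (use shift[of q] in auto)
    have "card ?L = card ?A + card ?B"
      unfolding eq by (rule card_Un_disjoint) auto
    also have "card ?B = r" unfolding r_def by (intro card_image) (auto simp: inj_on_def)
    finally show ?case using Suc by simp
  qed simp
  define q where "q = N div P"
  have N: "N = q * P + N mod P" "N mod P < P" using assms(1) by (auto simp: q_def)
  have lo: "q * r \<le> card {n. n < N \<and> Q n}"
    unfolding block[symmetric] using N(1) by (intro card_mono) auto
  have hi: "card {n. n < N \<and> Q n} \<le> Suc q * r"
    unfolding block[symmetric] using N by (intro card_mono) (auto)
  have "real q * real P \<le> real N" "real N \<le> (real q + 1) * real P"
  proof -
    have "q * P \<le> N" "N \<le> Suc q * P" using N by auto
    then have "real (q * P) \<le> real N" "real N \<le> real (Suc q * P)" by (simp_all only: of_nat_le_iff)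
    then show "real q * real P \<le> real N" "real N \<le> (real q + 1) * real P"
      by (simp_all add: algebra_simps)
  qed
  then have "real q \<le> real N / real P" "real N / real P \<le> real q + 1"
    using assms(1) by (simp_all add: field_simps)
  then have "real q * real r \<le> real N / real P * real r" "real N / real P * real r \<le> (real q + 1) * real r"
    by (intro mult_right_mono; simp)+
  moreover have "real q * real r \<le> real (card {n. n < N \<and> Q n})"
    using lo by (metis of_nat_le_iff of_nat_mult)
  moreover have "real (card {n. n < N \<and> Q n}) \<le> (real q + 1) * real r"
  proof -
    have "real (card {n. n < N \<and> Q n}) \<le> real (Suc q * r)" using hi by (simp only: of_nat_le_iff)
    then show ?thesis by (simp add: algebra_simps)
  qed
  ultimately show ?thesis by (simp add: algebra_simps abs_le_iff)
qed

text \<open>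
  The conditions are periodic modulo the product of \<open>S\<close>, and by the Chinese remainder theorem one
  period contains exactly \<open>\<Prod>p\<in>S. card (\<Omega> p)\<close> solutions; the incomplete last period costs at most
  that many.
\<close>

lemma card_residue_conditions:
  fixes \<Omega> :: "nat \<Rightarrow> nat set"
  assumes S: "finite S" "\<And>p. p \<in> S \<Longrightarrow> prime p" "\<And>p. p \<in> S \<Longrightarrow> \<Omega> p \<subseteq> {..<p}"
  shows "\<bar>real (card {n. n < N \<and> (\<forall>p\<in>S. n mod p \<in> \<Omega> p)}) -
      real N * (\<Prod>p\<in>S. real (card (\<Omega> p)) / real p)\<bar> \<le> (\<Prod>p\<in>S. real (card (\<Omega> p)))"
proof -
  have pos: "\<Prod>S > 0" by (rule prod_pos) (use S in \<open>simp add: prime_gt_0_nat\<close>)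
  have modS: "n mod \<Prod>S mod q = n mod q" if "q \<in> S" for n q
    using that S by (intro mod_mod_cancel dvd_prodI) auto
  have "\<bar>real (card {n. n < N \<and> (\<forall>p\<in>S. n mod p \<in> \<Omega> p)}) -
      real N * real (\<Prod>p\<in>S. card (\<Omega> p)) / real (\<Prod>S)\<bar> \<le> real (\<Prod>p\<in>S. card (\<Omega> p))"
  proof -
    have "(\<forall>p\<in>S. n mod \<Prod>S mod p \<in> \<Omega> p) \<longleftrightarrow> (\<forall>p\<in>S. n mod p \<in> \<Omega> p)" for n
      by (simp add: modS)
    note bounds = card_periodic_bounds[OF pos, where Q = "\<lambda>n. \<forall>p\<in>S. n mod p \<in> \<Omega> p" and N = N, OF this]
    have "card {n. n < \<Prod>S \<and> (\<forall>p\<in>S. n mod p \<in> \<Omega> p)} = (\<Prod>p\<in>S. card (\<Omega> p))"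
      using S by (rule card_residue_system)
    with bounds show ?thesis by (simp only:)
  qed
  then show ?thesis by (simp add: prod_dividef)
qed


section \<open>Selberg's upper bound sieve\<close>

text \<open>
  For \<open>l {} = 1\<close> the square of \<open>\<Sum> l S\<close>, over those \<open>S\<close> for which \<open>n mod p \<in> \<Omega> p\<close> at every \<open>p \<in> S\<close>,
  is nonnegative and equals 1 when \<open>n\<close> survives the sieve.  Summing it over \<open>n\<close> produces the
  quadratic form of \<open>selberg_weights\<close>.  Every remainder is at most \<open>\<rho> (S \<union> T) \<le> \<rho> S * \<rho> T\<close> with
  \<open>\<rho> S = \<Prod>p\<in>S. card (\<Omega> p)\<close>, and \<open>\<bar>l S\<bar> * \<rho> S \<le> \<Prod>S\<close> by the size bound on the weights.
\<close>

lemma selberg_sieve: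
  fixes \<Omega> :: "nat \<Rightarrow> nat set" and N :: nat
  assumes fin: "finite \<S>" and finS: "\<And>S. S \<in> \<S> \<Longrightarrow> finite S"
    and empty: "{} \<in> \<S>"
    and down: "\<And>S T. T \<in> \<S> \<Longrightarrow> S \<subseteq> T \<Longrightarrow> S \<in> \<S>"
    and prime: "\<And>S p. S \<in> \<S> \<Longrightarrow> p \<in> S \<Longrightarrow> prime p"
    and \<Omega>: "\<And>S p. S \<in> \<S> \<Longrightarrow> p \<in> S \<Longrightarrow> \<Omega> p \<subseteq> {..<p}"
    and card\<Omega>: "\<And>S p. S \<in> \<S> \<Longrightarrow> p \<in> S \<Longrightarrow> 0 < card (\<Omega> p) \<and> card (\<Omega> p) < p"
  defines "G \<equiv> (\<Sum>S\<in>\<S>. \<Prod>p\<in>S. real (card (\<Omega> p)) / (real p - real (card (\<Omega> p))))"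
  shows "real (card {n. n < N \<and> (\<forall>S\<in>\<S>. \<forall>p\<in>S. n mod p \<notin> \<Omega> p)}) \<le> 
    real N / G + (\<Sum>S\<in>\<S>. real (\<Prod>S))\<^sup>2"
proof -
  define g where "g p = real (card (\<Omega> p)) / real p" for p
  have g: "0 < g p \<and> g p < 1" if "S \<in> \<S>" "p \<in> S" for S p
    using card\<Omega>[OF that] by (auto simp: g_def)
  have G: "(\<Sum>S\<in>\<S>. prod (\<lambda>p. g p / (1 - g p)) S) = G"
    unfolding G_def
  proof (intro sum.cong prod.cong refl)
    fix S p assume "S \<in> \<S>" "p \<in> S"
    then show "g p / (1 - g p) = real (card (\<Omega> p)) / (real p - real (card (\<Omega> p)))"
      using card\<Omega>[of S p] by (simp add: g_def field_simps)
  qed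
  have "\<exists>l :: nat set \<Rightarrow> real. l {} = 1 \<and> (\<forall>S\<in>\<S>. \<bar>l S\<bar> * prod g S \<le> 1) \<and>
    (\<Sum>S\<in>\<S>. \<Sum>T\<in>\<S>. l S * l T * prod g (S \<union> T)) = 1 / G"
    unfolding G[symmetric] by (rule selberg_weights) (fact fin finS empty down g)+
  then obtain l :: "nat set \<Rightarrow> real" where l: "l {} = 1 \<and> (\<forall>S\<in>\<S>. \<bar>l S\<bar> * prod g S \<le> 1) \<and>
    (\<Sum>S\<in>\<S>. \<Sum>T\<in>\<S>. l S * l T * prod g (S \<union> T)) = 1 / G" ..
  then have l0: "l {} = 1"
    and lb: "\<And>S. S \<in> \<S> \<Longrightarrow> \<bar>l S\<bar> * prod g S \<le> 1"
    and lG: "(\<Sum>S\<in>\<S>. \<Sum>T\<in>\<S>. l S * l T * prod g (S \<union> T)) = 1 / G"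
    by blast+
  define \<rho> where "\<rho> S = (\<Prod>p\<in>S. real (card (\<Omega> p)))" for S
  define a where "a n S = (if \<forall>p\<in>S. n mod p \<in> \<Omega> p then 1 else 0 :: real)" for n S
  let ?sifted = "{n. n < N \<and> (\<forall>S\<in>\<S>. \<forall>p\<in>S. n mod p \<notin> \<Omega> p)}"
  have \<rho>1: "1 \<le> \<rho> S" if "S \<in> \<S>" for S
    unfolding \<rho>_def by (intro prod_ge_1) (use card\<Omega>[OF that] in fastforce)
  have l\<rho>: "\<bar>l S\<bar> * \<rho> S \<le> real (\<Prod>S)" if S: "S \<in> \<S>" for S
  proof -
    have pos: "real (\<Prod>S) > 0" using prime[OF S] by (simp add: prod_pos prime_gt_0_nat)
    have "prod g S = \<rho> S / real (\<Prod>S)" by (simp add: g_def \<rho>_def prod_dividef)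
    then show ?thesis using lb[OF S] pos by (simp add: field_simps)
  qed
  have err: "l S * l T * (\<Sum>n<N. a n (S \<union> T)) \<le> real N * (l S * l T * prod g (S \<union> T)) + real (\<Prod>S) * real (\<Prod>T)"
    if S: "S \<in> \<S>" and T: "T \<in> \<S>" for S T
  proof -
    have "(\<Sum>n<N. a n (S \<union> T)) = real (card {n. n < N \<and> (\<forall>p\<in>S\<union>T. n mod p \<in> \<Omega> p)})"
      unfolding a_def by (simp add: sum.If_cases Int_def lessThan_def)
    moreover have "\<bar>real (card {n. n < N \<and> (\<forall>p\<in>S\<union>T. n mod p \<in> \<Omega> p)}) - real N * prod g (S \<union> T)\<bar> \<le> \<rho> (S \<union> T)"
      unfolding \<rho>_def g_def
      by (rule card_residue_conditions) (use finite_UnI[of S T] finS[OF S] finS[OF T] prime[OF S] prime[OF T] \<Omega>[OF S] \<Omega>[OF T] in blast)+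
    ultimately have e: "\<bar>(\<Sum>n<N. a n (S \<union> T)) - real N * prod g (S \<union> T)\<bar> \<le> \<rho> (S \<union> T)" by simp
    have "S \<inter> T \<in> \<S>" using down[OF S] by auto
    from mult_left_mono[OF \<rho>1[OF this], of "\<rho> (S \<union> T)"]
    have "\<rho> (S \<union> T) \<le> \<rho> (S \<union> T) * \<rho> (S \<inter> T)"
      by (simp add: \<rho>_def prod_nonneg)
    also have "\<dots> = \<rho> S * \<rho> T" 
      unfolding \<rho>_def by (rule prod.union_inter[OF finS[OF S] finS[OF T]])
    finally have e2: "\<rho> (S \<union> T) \<le> \<rho> S * \<rho> T" .
    have "l S * l T * ((\<Sum>n<N. a n (S \<union> T)) - real N * prod g (S \<union> T)) \<le>
        \<bar>l S * l T * ((\<Sum>n<N. a n (S \<union> T)) - real N * prod g (S \<union> T))\<bar>" by (rule abs_ge_self)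
    also have "\<dots> \<le> \<bar>l S * l T\<bar> * (\<rho> S * \<rho> T)"
      unfolding abs_mult[of "l S * l T"] using e e2 by (intro mult_left_mono) auto
    also have "\<dots> = (\<bar>l S\<bar> * \<rho> S) * (\<bar>l T\<bar> * \<rho> T)" by (simp add: abs_mult)
    also have "\<dots> \<le> real (\<Prod>S) * real (\<Prod>T)"
    proof (rule mult_mono[OF l\<rho>[OF S] l\<rho>[OF T]])
      show "0 \<le> \<bar>l T\<bar> * \<rho> T" using \<rho>1[OF T] by simp
    qed (simp add: prod_nonneg)
    finally show ?thesis by (simp add: algebra_simps)
  qed
  have "real (card ?sifted) = (\<Sum>n\<in>?sifted. 1)" by simp
  also have "\<dots> \<le> (\<Sum>n\<in>?sifted. (\<Sum>S\<in>\<S>. l S * a n S)\<^sup>2)"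
  proof (rule sum_mono)
    fix n assume n: "n \<in> ?sifted"
    have "(\<Sum>S\<in>\<S>. l S * a n S) = (\<Sum>S\<in>{{}}. l S * a n S)"
      using fin empty n by (intro sum.mono_neutral_right) (auto simp: a_def)
    also have "\<dots> = 1" by (simp add: l0 a_def)
    finally show "1 \<le> (\<Sum>S\<in>\<S>. l S * a n S)\<^sup>2" by simp
  qed
  also have "\<dots> \<le> (\<Sum>n<N. (\<Sum>S\<in>\<S>. l S * a n S)\<^sup>2)"
    by (intro sum_mono2) auto
  also have "\<dots> = (\<Sum>n<N. \<Sum>S\<in>\<S>. \<Sum>T\<in>\<S>. l S * l T * a n (S \<union> T))"
    unfolding power2_eq_square sum_product by (intro sum.cong refl) (auto simp: a_def)
  also have "\<dots> = (\<Sum>S\<in>\<S>. \<Sum>n<N. \<Sum>T\<in>\<S>. l S * l T * a n (S \<union> T))" by (rule sum.swap)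
  also have "\<dots> = (\<Sum>S\<in>\<S>. \<Sum>T\<in>\<S>. \<Sum>n<N. l S * l T * a n (S \<union> T))"
    by (intro sum.cong sum.swap refl)
  also have "\<dots> = (\<Sum>S\<in>\<S>. \<Sum>T\<in>\<S>. l S * l T * (\<Sum>n<N. a n (S \<union> T)))"
    by (simp add: sum_distrib_left)
  also have "\<dots> \<le> (\<Sum>S\<in>\<S>. \<Sum>T\<in>\<S>. real N * (l S * l T * prod g (S \<union> T)) + real (\<Prod>S) * real (\<Prod>T))"
    by (intro sum_mono err)
  also have "\<dots> = real N * (\<Sum>S\<in>\<S>. \<Sum>T\<in>\<S>. l S * l T * prod g (S \<union> T)) + (\<Sum>S\<in>\<S>. real (\<Prod>S))\<^sup>2"
    unfolding power2_eq_square sum_product sum.distrib by (simp only: sum_distrib_left)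
  finally show ?thesis by (simp add: lG)
qed

section \<open>Squarefree numbers as sets of primes\<close>

definition prime_sets :: "real \<Rightarrow> nat set set" where
  "prime_sets z = {S. finite S \<and> (\<forall>p\<in>S. prime p) \<and> real (\<Prod>S) \<le> z}"

lemma prime_factors_prod_primes:
  assumes "finite S" "\<And>p. p \<in> S \<Longrightarrow> prime (p::nat)"
  shows "prime_factors (\<Prod>S) = S"
proof -
  have "\<Prod>S > 0" by (rule prod_pos) (use assms in \<open>simp add: prime_gt_0_nat\<close>)
  then have "q \<in> prime_factors (\<Prod>S) \<longleftrightarrow> q \<in> S" for q
  proof -
    have "q dvd \<Prod>S \<longleftrightarrow> (\<exists>a\<in>S. q dvd a)" if "prime q"
      using assms(1) that by (rule prime_dvd_prod_iff)
    moreover have "(\<exists>a\<in>S. q dvd a) \<longleftrightarrow> q \<in> S" if "prime q"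
      using assms(2) primes_dvd_imp_eq[OF that] by (metis dvd_refl)
    ultimately show ?thesis using \<open>\<Prod>S > 0\<close> assms(2) by (auto simp: in_prime_factors_iff)
  qed
  then show ?thesis by blast
qed

lemma inj_on_prod_prime_sets: "inj_on (\<lambda>S. \<Prod>S) (prime_sets z)"
  by (rule inj_on_inverseI[where g = prime_factors])
     (auto simp: prime_sets_def prime_factors_prod_primes)

lemma prod_prime_sets_range:
  assumes "S \<in> prime_sets z"
  shows "\<Prod>S \<in> {1..nat \<lfloor>z\<rfloor>}"
proof -
  have "\<Prod>S > 0" using assms by (intro prod_pos) (auto simp: prime_sets_def prime_gt_0_nat)
  moreover have "\<Prod>S \<le> nat \<lfloor>z\<rfloor>" using assms unfolding prime_sets_def by (intro le_nat_floor) auto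
  ultimately show ?thesis by simp
qed

lemma finite_prime_sets: "finite (prime_sets z)"
  using inj_on_prod_prime_sets
  by (rule inj_on_finite[where B = "{1..nat \<lfloor>z\<rfloor>}"]) (use prod_prime_sets_range in blast)+

lemma prime_sets_subset:
  assumes "T \<in> prime_sets z" "S \<subseteq> T"
  shows "S \<in> prime_sets z"
proof -
  have "finite S" using assms finite_subset by (auto simp: prime_sets_def)
  moreover have "\<Prod>S \<le> \<Prod>T"
    using assms by (intro dvd_imp_le prod_dvd_prod_subset prod_pos)
      (auto simp: prime_sets_def prime_gt_0_nat)
  then have "real (\<Prod>S) \<le> real (\<Prod>T)" by (simp only: of_nat_le_iff)
  ultimately show ?thesis using assms unfolding prime_sets_def by auto
qed

lemma prime_sets_member_le:
  assumes "S \<in> prime_sets z" "p \<in> S"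
  shows "real p \<le> z"
  using prime_sets_subset[of S z "{p}"] assms by (auto simp: prime_sets_def)

lemma sum_prod_prime_sets_le:
  assumes "z \<ge> 0"
  shows "(\<Sum>S\<in>prime_sets z. real (\<Prod>S)) \<le> z\<^sup>2"
proof -
  have "(\<Sum>S\<in>prime_sets z. real (\<Prod>S)) = (\<Sum>m\<in>(\<lambda>S. \<Prod>S) ` prime_sets z. real m)"
    by (simp only: sum.reindex[OF inj_on_prod_prime_sets] o_def)
  also have "\<dots> \<le> (\<Sum>m\<in>{1..nat \<lfloor>z\<rfloor>}. real m)"
    by (rule sum_mono2, simp, use prod_prime_sets_range in blast, simp)
  also have "\<dots> \<le> (\<Sum>m\<in>{1..nat \<lfloor>z\<rfloor>}. z)"
    by (rule sum_mono) (use assms in \<open>auto simp: le_nat_iff le_floor_iff\<close>)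
  also have "\<dots> = real (nat \<lfloor>z\<rfloor>) * z" by simp
  also have "\<dots> \<le> z * z" using assms by (intro mult_right_mono) (auto simp: of_nat_floor)
  finally show ?thesis by (simp add: power2_eq_square)
qed

text \<open>
  The Dirichlet product of two squarefree-supported functions, with lcm in place of
  multiplication: the pairs \<open>(A, B)\<close> with union \<open>E\<close> assign every \<open>x \<in> E\<close> to \<open>A\<close> only, to \<open>B\<close> only, or to
  both, which gives the three summands of the factor at \<open>x\<close>.
\<close>

lemma sum_prod_over_unions:
  fixes f g :: "'a \<Rightarrow> real"
  assumes fin: "finite \<E>" "\<And>E. E \<in> \<E> \<Longrightarrow> finite E"
  shows "finite {(A, B). A \<union> B \<in> \<E>}"
    and "(\<Sum>(A, B) | A \<union> B \<in> \<E>. prod f A * prod g B) = (\<Sum>E\<in>\<E>. \<Prod>x\<in>E. f x + g x + f x * g x)"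
proof -
  have sub: "{(A, B). A \<union> B \<in> \<E>} \<subseteq> Pow (\<Union>\<E>) \<times> Pow (\<Union>\<E>)" by auto
  show finP: "finite {(A, B). A \<union> B \<in> \<E>}"
    by (rule finite_subset[OF sub]) (use fin in auto)
  have one: "(\<Sum>(A, B) | A \<union> B = E. prod f A * prod g B) = (\<Prod>x\<in>E. f x + g x + f x * g x)"
    if "E \<in> \<E>" for E
  proof -
    have finE: "finite E" using fin that by blast
    have "(\<Prod>x\<in>E. f x + g x + f x * g x) = (\<Prod>x\<in>E. f x * (1 + g x) + g x)"
      by (simp add: algebra_simps)
    also have "\<dots> = (\<Sum>A\<in>Pow E. prod (\<lambda>x. f x * (1 + g x)) A * prod g (E - A))"
      by (rule prod_add[OF finE])
    also have "\<dots> = (\<Sum>A\<in>Pow E. \<Sum>C\<in>Pow A. prod f A * prod g (C \<union> (E - A)))"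
    proof (rule sum.cong)
      fix A assume A: "A \<in> Pow E"
      then have finA: "finite A" using finE finite_subset by blast
      have "prod (\<lambda>x. f x * (1 + g x)) A * prod g (E - A) =
          prod f A * ((\<Sum>C\<in>Pow A. prod g C) * prod g (E - A))"
        by (simp add: prod.distrib prod_one_plus_eq_sum_Pow[OF finA])
      also have "\<dots> = (\<Sum>C\<in>Pow A. prod f A * (prod g C * prod g (E - A)))"
        by (simp add: sum_distrib_left sum_distrib_right)
      also have "\<dots> = (\<Sum>C\<in>Pow A. prod f A * prod g (C \<union> (E - A)))"
      proof (rule sum.cong)
        fix C assume "C \<in> Pow A"
        then have "prod g (C \<union> (E - A)) = prod g C * prod g (E - A)"
          using finA finE finite_subset[of C A] by (intro prod.union_disjoint) auto
        then show "prod f A * (prod g C * prod g (E - A)) = prod f A * prod g (C \<union> (E - A))" by simp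
      qed simp
      finally show "prod (\<lambda>x. f x * (1 + g x)) A * prod g (E - A) =
          (\<Sum>C\<in>Pow A. prod f A * prod g (C \<union> (E - A)))" .
    qed simp
    also have "\<dots> = (\<Sum>(A, C)\<in>Sigma (Pow E) Pow. prod f A * prod g (C \<union> (E - A)))"
      using finE by (intro sum.Sigma) (auto intro: finite_subset)
    also have "\<dots> = (\<Sum>(A, B) | A \<union> B = E. prod f A * prod g B)"
    proof (rule sum.reindex_bij_witness[where i = "\<lambda>(A, B). (A, A \<inter> B)" and j = "\<lambda>(A, C). (A, C \<union> (E - A))"])
      fix X assume X: "X \<in> {(A, B). A \<union> B = E}"
      then obtain A B where X: "X = (A, B)" "A \<union> B = E" by auto
      have "A \<inter> B \<union> (E - A) = B" using X(2) by auto
      then show "(case case X of (A, B) \<Rightarrow> (A, A \<inter> B) of (A, C) \<Rightarrow> (A, C \<union> (E - A))) = X"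
        by (simp add: X(1))
    qed auto
    finally show ?thesis ..
  qed
  have "(\<Sum>(A, B) | A \<union> B \<in> \<E>. prod f A * prod g B) =
      (\<Sum>E\<in>\<E>. \<Sum>(A, B) | (A, B) \<in> {(A, B). A \<union> B \<in> \<E>} \<and> A \<union> B = E. prod f A * prod g B)"
    using sum.group[OF finP fin(1), of "\<lambda>(A, B). A \<union> B" "\<lambda>(A, B). prod f A * prod g B", symmetric]
    by (force simp: case_prod_unfold)
  also have "\<dots> = (\<Sum>E\<in>\<E>. \<Sum>(A, B) | A \<union> B = E. prod f A * prod g B)"
    by (rule sum.cong[OF refl], rule sum.cong) auto
  also have "\<dots> = (\<Sum>E\<in>\<E>. \<Prod>x\<in>E. f x + g x + f x * g x)"
    by (rule sum.cong[OF refl one])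
  finally show "(\<Sum>(A, B) | A \<union> B \<in> \<E>. prod f A * prod g B) = (\<Sum>E\<in>\<E>. \<Prod>x\<in>E. f x + g x + f x * g x)" .
qed

text \<open>
  In the expanded square, \<open>A\<close> and \<open>B\<close> of product at most \<open>y\<close> have a union of product at most \<open>y\<^sup>2\<close>;
  grouping the pairs by their union turns a one-dimensional density into a two-dimensional one.
\<close>

lemma sum_prime_sets_squared_le:
  fixes f :: "nat \<Rightarrow> real"
  assumes f: "\<And>p. f p \<ge> 0" and "y \<ge> 0"
  shows "(\<Sum>S\<in>prime_sets y. prod f S)\<^sup>2 \<le> (\<Sum>E\<in>prime_sets (y\<^sup>2). \<Prod>p\<in>E. 2 * f p + (f p)\<^sup>2)"
proof -
  have union: "A \<union> B \<in> prime_sets (y\<^sup>2)" if A: "A \<in> prime_sets y" and B: "B \<in> prime_sets y" for A B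
  proof -
    have fin: "finite A" "finite B" using A B by (auto simp: prime_sets_def)
    have "\<Prod>(A \<inter> B) \<ge> 1" 
      using prod_prime_sets_range[OF prime_sets_subset[OF A, of "A \<inter> B"]] by auto
    then have "\<Prod>(A \<union> B) * 1 \<le> \<Prod>(A \<union> B) * \<Prod>(A \<inter> B)" by (rule mult_le_mono2)
    also have "\<dots> = \<Prod>A * \<Prod>B" by (rule prod.union_inter[OF fin])
    finally have "real (\<Prod>(A \<union> B)) \<le> real (\<Prod>A * \<Prod>B)" by (simp only: of_nat_le_iff mult_1_right)
    also have "\<dots> = real (\<Prod>A) * real (\<Prod>B)" by (rule of_nat_mult)
    also have "\<dots> \<le> y * y" 
      using A B assms(2) unfolding prime_sets_def by (intro mult_mono) (auto intro: prod_nonneg)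
    finally show ?thesis using A B unfolding prime_sets_def power2_eq_square by auto
  qed
  have "(\<Sum>S\<in>prime_sets y. prod f S)\<^sup>2 = (\<Sum>(A, B)\<in>prime_sets y \<times> prime_sets y. prod f A * prod f B)"
    by (simp add: power2_eq_square sum_product sum.cartesian_product)
  also have "\<dots> \<le> (\<Sum>(A, B) | A \<union> B \<in> prime_sets (y\<^sup>2). prod f A * prod f B)"
    by (rule sum_mono2[OF sum_prod_over_unions(1)[OF finite_prime_sets]])
       (auto simp: prime_sets_def[of "y^2"] f prod_nonneg dest: union)
  also have "\<dots> = (\<Sum>E\<in>prime_sets (y\<^sup>2). \<Prod>p\<in>E. f p + f p + f p * f p)"
    by (rule sum_prod_over_unions(2)[OF finite_prime_sets]) (auto simp: prime_sets_def)
  finally show ?thesis by (simp add: power2_eq_square)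
qed

text \<open>
  The sieve density \<open>h\<close> is only one-dimensional at the primes in \<open>D\<close>.  Multiplying by
  \<open>\<Prod>p\<in>D. 1 + h p\<close> and grouping pairs by their union makes it two-dimensional there as well.
\<close>

lemma sum_prime_sets_absorb_factor:
  fixes h :: "nat \<Rightarrow> real"
  assumes h: "\<And>p. p \<in> D \<Longrightarrow> h p \<ge> 0" "\<And>S p. S \<in> prime_sets z \<Longrightarrow> p \<in> S \<Longrightarrow> h p \<ge> 0" and D: "finite D"
  shows "(\<Sum>E\<in>prime_sets z. \<Prod>p\<in>E. if p \<in> D then 2 * h p + (h p)\<^sup>2 else h p)
    \<le> (\<Prod>p\<in>D. 1 + h p) * (\<Sum>E\<in>prime_sets z. prod h E)"
proof -
  define f where "f p = (if p \<in> D then h p else 0)" for p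
  have fin: "finite E" if "E \<in> prime_sets z" for E using that by (auto simp: prime_sets_def)
  have "(\<Sum>E\<in>prime_sets z. \<Prod>p\<in>E. if p \<in> D then 2 * h p + (h p)\<^sup>2 else h p) =
      (\<Sum>E\<in>prime_sets z. \<Prod>p\<in>E. f p + h p + f p * h p)"
    by (intro sum.cong prod.cong) (auto simp: f_def power2_eq_square)
  also have "\<dots> = (\<Sum>(A, B) | A \<union> B \<in> prime_sets z. prod f A * prod h B)"
    by (rule sum_prod_over_unions(2)[symmetric]) (auto simp: finite_prime_sets fin)
  also have "\<dots> = (\<Sum>(A, B) | A \<union> B \<in> prime_sets z \<and> A \<subseteq> D. prod h A * prod h B)"
  proof (rule sum.mono_neutral_cong_right)
    show "finite {(A, B). A \<union> B \<in> prime_sets z}"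
      by (rule sum_prod_over_unions(1)) (auto simp: finite_prime_sets fin)
    show "\<forall>i\<in>{(A, B). A \<union> B \<in> prime_sets z} - {(A, B). A \<union> B \<in> prime_sets z \<and> A \<subseteq> D}.
       (case i of (A, B) \<Rightarrow> prod f A * prod h B) = 0"
    proof
      fix X assume "X \<in> {(A, B). A \<union> B \<in> prime_sets z} - {(A, B). A \<union> B \<in> prime_sets z \<and> A \<subseteq> D}"
      then obtain A B where X: "X = (A, B)" and AB: "A \<union> B \<in> prime_sets z" "\<not> A \<subseteq> D" by auto
      then obtain p where "p \<in> A" "p \<notin> D" by auto
      moreover have "finite A" using fin[OF AB(1)] by simp
      ultimately have "prod f A = 0" by (auto simp: f_def prod_zero_iff)
      then show "(case X of (A, B) \<Rightarrow> prod f A * prod h B) = 0" by (simp add: X)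
    qed
    fix X assume "X \<in> {(A, B). A \<union> B \<in> prime_sets z \<and> A \<subseteq> D}"
    moreover have "prod f A = prod h A" if "A \<subseteq> D" for A
      using that by (intro prod.cong) (auto simp: f_def)
    ultimately show "(case X of (A, B) \<Rightarrow> prod f A * prod h B) = (case X of (A, B) \<Rightarrow> prod h A * prod h B)" by auto
  qed auto
  also have "\<dots> \<le> (\<Sum>(A, B)\<in>Pow D \<times> prime_sets z. prod h A * prod h B)"
  proof (rule sum_mono2)
    show "finite (Pow D \<times> prime_sets z)" using D finite_prime_sets by simp
    show "{(A, B). A \<union> B \<in> prime_sets z \<and> A \<subseteq> D} \<subseteq> Pow D \<times> prime_sets z"
      using prime_sets_subset by auto
    fix X assume "X \<in> Pow D \<times> prime_sets z - {(A, B). A \<union> B \<in> prime_sets z \<and> A \<subseteq> D}"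
    then show "0 \<le> (case X of (A, B) \<Rightarrow> prod h A * prod h B)"
      using h by (auto intro!: mult_nonneg_nonneg prod_nonneg)
  qed
  also have "\<dots> = (\<Prod>p\<in>D. 1 + h p) * (\<Sum>E\<in>prime_sets z. prod h E)"
    by (simp add: prod_one_plus_eq_sum_Pow[OF D] sum_product sum.cartesian_product)
  finally show ?thesis .
qed

lemma sum_inverse_squares_le: "(\<Sum>k=1..n. 1 / (real k)\<^sup>2) \<le> 2"
proof -
  have "(\<Sum>k=1..Suc n. 1 / (real k)\<^sup>2) \<le> 2 - 1 / real (Suc n)" for n
  proof (induction n)
    case (Suc n)
    have "1 / (real (Suc (Suc n)))\<^sup>2 \<le> 1 / (real (Suc n) * real (Suc (Suc n)))"
      unfolding power2_eq_square by (intro divide_left_mono mult_right_mono) auto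
    also have "\<dots> = 1 / real (Suc n) - 1 / real (Suc (Suc n))" by (simp add: field_simps)
    finally show ?case using Suc by simp
  qed simp
  from this[of "n - 1"] show ?thesis by (cases n) (auto intro: order_trans)
qed

text \<open>
  Every \<open>a \<le> y\<close> is uniquely a squarefree number times a square, so the harmonic sum up to \<open>y\<close> is at
  most the sum over squarefree numbers times \<open>\<Sum> 1 / k\<^sup>2 \<le> 2\<close>.
\<close>

lemma ln_le_sum_prime_sets:
  assumes "y \<ge> 1"
  shows "ln y \<le> 2 * (\<Sum>S\<in>prime_sets y. \<Prod>p\<in>S. 1 / real p)"
proof -
  define n where "n = nat \<lfloor>y\<rfloor>"
  define \<phi> where "\<phi> a = (prime_factors (squarefree_part a), square_part a)" for a :: nat
  have sfp: "\<Prod>(prime_factors (squarefree_part a)) = squarefree_part a" if "a > 0" for a :: nat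
  proof -
    have "squarefree_part a = (\<Prod>p\<in>prime_factors (squarefree_part a). p ^ multiplicity p (squarefree_part a))"
      by (rule prime_factorization_nat) (simp add: squarefree_part_nonzero[of a, unfolded neq0_conv])
    also have "\<dots> = (\<Prod>p\<in>prime_factors (squarefree_part a). p)"
    proof (rule prod.cong)
      fix p assume p: "p \<in> prime_factors (squarefree_part a)"
      then have "multiplicity p (squarefree_part a) > 0" by (simp add: prime_factors_multiplicity)
      moreover have "multiplicity p (squarefree_part a) \<le> Suc 0"
        using p by (intro prime_multiplicity_squarefree_part_le_Suc_0) auto
      ultimately have "multiplicity p (squarefree_part a) = 1" by linarith
      then show "p ^ multiplicity p (squarefree_part a) = p" by (simp only: power_one_right)
    qed simp
    finally show ?thesis ..
  qed
  have decomp: "a = \<Prod>(fst (\<phi> a)) * (snd (\<phi> a))\<^sup>2" if "a > 0" for a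
    using squarefree_decompose[of a] sfp[OF that] by (simp add: \<phi>_def)
  have inj: "inj_on \<phi> {1..n}"
  proof (rule inj_onI)
    fix a b assume "a \<in> {1..n}" "b \<in> {1..n}" "\<phi> a = \<phi> b"
    then show "a = b" using decomp[of a] decomp[of b] by auto
  qed
  have range: "\<phi> ` {1..n} \<subseteq> prime_sets y \<times> {1..n}"
  proof
    fix X assume "X \<in> \<phi> ` {1..n}"
    then obtain a where a: "X = \<phi> a" "a \<ge> 1" "a \<le> n" by auto
    have ay: "real a \<le> y" using a assms by (simp add: n_def le_nat_iff le_floor_iff)
    have d: "a = \<Prod>(fst X) * (snd X)\<^sup>2" using decomp a by auto
    then have nz: "snd X \<noteq> 0" using a by (intro notI) simp
    then have "\<Prod>(fst X) \<le> a" by (subst d) simp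
    then have "real (\<Prod>(fst X)) \<le> real a" by (simp only: of_nat_le_iff)
    then have "fst X \<in> prime_sets y" using ay unfolding prime_sets_def a(1) \<phi>_def by auto
    moreover have "snd X dvd a" by (subst d) (simp add: power2_eq_square)
    then have "snd X \<le> n" using a dvd_imp_le[of "snd X" a] by simp
    ultimately show "X \<in> prime_sets y \<times> {1..n}" using nz by (cases X) auto
  qed
  have "ln y \<le> ln (real n + 1)" 
  proof -
    have "y \<le> real n + 1" using assms unfolding n_def by linarith
    then show ?thesis using assms by simp
  qed
  also have "\<dots> \<le> harm n" by (rule harm_ge_ln)
  also have "\<dots> = (\<Sum>a\<in>{1..n}. (case \<phi> a of (S, k) \<Rightarrow> (\<Prod>p\<in>S. 1 / real p) * (1 / (real k)\<^sup>2)))"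
    unfolding harm_def
  proof (rule sum.cong)
    fix a assume "a \<in> {1..n}"
    then have "a > 0" by simp
    from arg_cong[OF decomp[OF this], of real]
    show "inverse (real a) = (case \<phi> a of (S, k) \<Rightarrow> (\<Prod>p\<in>S. 1 / real p) * (1 / (real k)\<^sup>2))"
      by (simp add: case_prod_unfold prod_dividef field_simps)
  qed simp
  also have "\<dots> = (\<Sum>(S, k)\<in>\<phi> ` {1..n}. (\<Prod>p\<in>S. 1 / real p) * (1 / (real k)\<^sup>2))"
    by (simp only: sum.reindex[OF inj] o_def)
  also have "\<dots> \<le> (\<Sum>(S, k)\<in>prime_sets y \<times> {1..n}. (\<Prod>p\<in>S. 1 / real p) * (1 / (real k)\<^sup>2))"
    by (rule sum_mono2[OF _ range]) (auto simp: finite_prime_sets intro!: prod_nonneg divide_nonneg_nonneg)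
  also have "\<dots> = (\<Sum>S\<in>prime_sets y. \<Prod>p\<in>S. 1 / real p) * (\<Sum>k=1..n. 1 / (real k)\<^sup>2)"
    by (simp only: sum_product sum.cartesian_product)
  also have "\<dots> \<le> (\<Sum>S\<in>prime_sets y. \<Prod>p\<in>S. 1 / real p) * 2"
    by (intro mult_left_mono sum_inverse_squares_le sum_nonneg prod_nonneg) auto
  finally show ?thesis by simp
qed

section \<open>The ratio of a number to its totient, on average\<close>

text \<open>
  By Euler's product formula this is \<open>d / \<phi>(d)\<close>; only the product is ever used.
\<close>

definition totient_ratio :: "nat \<Rightarrow> real" where
  "totient_ratio d = (\<Prod>p\<in>prime_factors d. 1 + 1 / (real p - 1))"

lemma totient_ratio_ge_1: "totient_ratio d \<ge> 1"
  unfolding totient_ratio_def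
  by (rule prod_ge_1) (auto dest!: in_prime_factors_imp_prime prime_ge_2_nat)

text \<open>
  Expanding the product over the primes dividing \<open>d\<close> and exchanging the summations, each set \<open>S\<close>
  of primes contributes \<open>prod h S / \<Prod>S\<close> times at most a full harmonic sum, where
  \<open>h p = 1 / (p - 1)\<close>.  The resulting Euler product of \<open>1 + 1 / (p (p - 1))\<close> is at most \<open>exp 1\<close>
  because \<open>\<Sum> 1 / (n (n - 1))\<close> telescopes.
\<close>

lemma sum_totient_ratio_div_le:
  "(\<Sum>d=1..D. totient_ratio d / real d) \<le> exp 1 * (\<Sum>d=1..D. 1 / real d)"
proof -
  define P where "P = {p. prime p \<and> p \<le> D}"
  define h where "h p = 1 / (real p - 1)" for p :: nat
  have finP: "finite P" unfolding P_def by simp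
  have hpos: "h p \<ge> 0" if "prime p" for p using prime_ge_2_nat[OF that] by (simp add: h_def)
  have "(\<Sum>d=1..D. totient_ratio d / real d) =
      (\<Sum>d=1..D. \<Sum>S\<in>Pow P. if \<Prod>S dvd d then prod h S / real d else 0)"
  proof (rule sum.cong)
    fix d assume d: "d \<in> {1..D}"
    have "totient_ratio d = (\<Sum>S\<in>Pow (prime_factors d). prod h S)"
      unfolding totient_ratio_def h_def by (rule prod_one_plus_eq_sum_Pow) simp
    also have "\<dots> = (\<Sum>S\<in>Pow P. if \<Prod>S dvd d then prod h S else 0)"
    proof (rule sum.mono_neutral_cong_left)
      have sub: "prime_factors d \<subseteq> P"
        using d dvd_imp_le[of _ d] by (auto simp: P_def in_prime_factors_iff intro: order_trans)
      then show "Pow (prime_factors d) \<subseteq> Pow P" by blast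
      show "\<forall>S\<in>Pow P - Pow (prime_factors d). (if \<Prod>S dvd d then prod h S else 0) = 0"
      proof
        fix S assume S: "S \<in> Pow P - Pow (prime_factors d)"
        then obtain p where p: "p \<in> S" "p \<notin> prime_factors d" by auto
        then have "prime p" using S by (auto simp: P_def)
        then have "\<not> p dvd d" using p d by (auto simp: in_prime_factors_iff)
        moreover have "p dvd \<Prod>S" using p S finP finite_subset[of S P] by (intro dvd_prodI) auto
        ultimately have "\<not> \<Prod>S dvd d" using dvd_trans by blast
        then show "(if \<Prod>S dvd d then prod h S else 0) = 0" by simp
      qed
      fix S assume "S \<in> Pow (prime_factors d)"
      then have S: "S \<subseteq> prime_factors d" by simp
      have "\<Prod>S dvd \<Prod>(prime_factors d)" using S by (intro prod_dvd_prod_subset) auto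
      also have "\<dots> dvd (\<Prod>p\<in>prime_factors d. p ^ multiplicity p d)"
        by (rule prod_dvd_prod) (auto simp: prime_factors_multiplicity intro!: dvd_power)
      also have "\<dots> = d" using prime_factorization_nat[of d] d by simp
      finally show "prod h S = (if \<Prod>S dvd d then prod h S else 0)" by simp
    qed (use finP in simp)
    finally show "totient_ratio d / real d = (\<Sum>S\<in>Pow P. if \<Prod>S dvd d then prod h S / real d else 0)"
      by (auto simp: sum_divide_distrib intro!: sum.cong)
  qed simp
  also have "\<dots> = (\<Sum>S\<in>Pow P. \<Sum>d=1..D. if \<Prod>S dvd d then prod h S / real d else 0)"
    by (rule sum.swap)
  also have "\<dots> \<le> (\<Sum>S\<in>Pow P. prod h S / real (\<Prod>S) * (\<Sum>d=1..D. 1 / real d))"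
  proof (rule sum_mono)
    fix S assume "S \<in> Pow P"
    then have prS: "\<And>p. p \<in> S \<Longrightarrow> prime p" by (auto simp: P_def)
    have pos: "\<Prod>S > 0" by (rule prod_pos) (use prS in \<open>simp add: prime_gt_0_nat\<close>)
    have hS: "prod h S \<ge> 0" by (rule prod_nonneg) (use prS hpos in auto)
    have "(\<Sum>d=1..D. if \<Prod>S dvd d then prod h S / real d else 0) = 
        (\<Sum>d\<in>{d\<in>{1..D}. \<Prod>S dvd d}. prod h S / real d)"
      by (rule sum.inter_filter[symmetric]) simp
    also have "\<dots> \<le> (\<Sum>d\<in>(\<lambda>k. \<Prod>S * k) ` {1..D}. prod h S / real d)"
    proof (rule sum_mono2)
      show "{d \<in> {1..D}. \<Prod>S dvd d} \<subseteq> (\<lambda>k. \<Prod>S * k) ` {1..D}"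
      proof
        fix d assume d: "d \<in> {d \<in> {1..D}. \<Prod>S dvd d}"
        then obtain k where k: "d = \<Prod>S * k" by auto
        have "k \<ge> 1" using d k by (cases k) auto
        moreover have "k \<le> d" using k pos by (metis le_square mult.commute mult_le_mono1 nat_mult_1 not_less_eq_eq One_nat_def Suc_leI)
        ultimately have "k \<in> {1..D}" using d by simp
        with k show "d \<in> (\<lambda>k. \<Prod>S * k) ` {1..D}" by (rule image_eqI)
      qed
    qed (use hS in auto)
    also have "\<dots> = (\<Sum>k=1..D. prod h S / real (\<Prod>S * k))"
      by (rule sum.reindex_cong[OF _ refl refl]) (use pos in \<open>auto simp: inj_on_def\<close>)
    also have "\<dots> = prod h S / real (\<Prod>S) * (\<Sum>d=1..D. 1 / real d)"
      by (simp only: sum_distrib_left of_nat_mult times_divide_times_eq mult_1_right)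
    finally show "(\<Sum>d=1..D. if \<Prod>S dvd d then prod h S / real d else 0) \<le>
       prod h S / real (\<Prod>S) * (\<Sum>d=1..D. 1 / real d)" .
  qed
  also have "\<dots> = (\<Prod>p\<in>P. 1 + h p / real p) * (\<Sum>d=1..D. 1 / real d)"
    by (simp add: prod_one_plus_eq_sum_Pow[OF finP] prod_dividef sum_distrib_right)
  also have "\<dots> \<le> exp 1 * (\<Sum>d=1..D. 1 / real d)"
  proof (rule mult_right_mono)
    have tele: "(\<Sum>n\<in>{2..N}. 1 / ((real n - 1) * real n)) \<le> 1" for N
    proof -
      have "(\<Sum>n\<in>{2..N}. 1 / ((real n - 1) * real n)) \<le> 1 - 1 / real N" if "N \<ge> 1"
        using that
      proof (induction N rule: dec_induct)
        case (step n)
        have "{2..Suc n} = insert (Suc n) {2..n}" using step by auto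
        then have "(\<Sum>n\<in>{2..Suc n}. 1 / ((real n - 1) * real n)) = 
           1 / ((real (Suc n) - 1) * real (Suc n)) + (\<Sum>n\<in>{2..n}. 1 / ((real n - 1) * real n))"
          by (simp only: sum.insert[OF finite_atLeastAtMost]) simp
        moreover have "1 / ((real (Suc n) - 1) * real (Suc n)) = 1 / real n - 1 / real (Suc n)"
          using step by (simp add: field_simps)
        ultimately show ?case using step by simp
      qed simp
      moreover have "(1::real) - 1 / real N \<le> 1" by simp
      ultimately show ?thesis by (cases "N \<ge> 1") (linarith, simp)
    qed
    have "(\<Prod>p\<in>P. 1 + h p / real p) \<le> (\<Prod>p\<in>P. exp (h p / real p))"
      by (rule prod_mono) (use hpos in \<open>auto simp: P_def intro: exp_ge_add_one_self add_nonneg_nonneg\<close>)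
    also have "\<dots> = exp (\<Sum>p\<in>P. h p / real p)" by (simp add: exp_sum finP)
    also have "(\<Sum>p\<in>P. h p / real p) \<le> (\<Sum>n\<in>{2..D}. h n / real n)"
      by (rule sum_mono2) (auto simp: P_def h_def prime_ge_2_nat)
    also have "\<dots> \<le> 1" using tele[of D] by (simp add: h_def)
    finally show "(\<Prod>p\<in>P. 1 + h p / real p) \<le> exp 1" by simp
  qed (simp add: sum_nonneg)
  finally show ?thesis .
qed

section \<open>Pairs of primes with a given difference\<close>

text \<open>
  The classes modulo \<open>p\<close> in which \<open>p\<close> divides \<open>n\<close> or \<open>n + d\<close>.
\<close>

definition pair_residues :: "nat \<Rightarrow> nat \<Rightarrow> nat set" where
  "pair_residues d p = {n. n < p \<and> (n = 0 \<or> p dvd n + d)}"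

lemma card_pair_residues:
  assumes "prime p"
  shows "card (pair_residues d p) = (if p dvd d then 1 else 2)"
proof (cases "p dvd d")
  case True
  then have "pair_residues d p = {0}"
    using prime_gt_0_nat[OF assms] by (auto simp: pair_residues_def dvd_add_left_iff dest: nat_dvd_not_less)
  then show ?thesis using True by simp
next
  case False
  have p: "p > 0" using assms by (rule prime_gt_0_nat)
  have "d mod p \<noteq> 0" using False by (simp add: mod_eq_0_iff_dvd)
  have mem: "n \<in> pair_residues d p \<longleftrightarrow> n \<in> {0, p - d mod p}" for n
  proof
    assume n: "n \<in> pair_residues d p"
    show "n \<in> {0, p - d mod p}"
    proof (cases "n = 0")
      case nz: False
      then have "n < p" "p dvd n + d" using n by (auto simp: pair_residues_def)
      then have "p dvd n + d mod p" by (metis mod_add_right_eq mod_eq_0_iff_dvd)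
      then obtain k where k: "n + d mod p = p * k" by auto
      have "n + d mod p < p * 2" using \<open>n < p\<close> mod_less_divisor[OF p, of d] by linarith
      then have "k < 2" unfolding k using p by simp
      moreover have "k \<noteq> 0" using k nz by (intro notI) simp
      ultimately have "k = 1" by linarith
      then have "n + d mod p = p" using k by simp
      then have "n = p - d mod p" by (metis add_diff_cancel_right')
      then show ?thesis by simp
    qed simp
  next
    assume n: "n \<in> {0, p - d mod p}"
    have "p dvd (p - d mod p) + d"
    proof -
      have "(p - d mod p) + d = p + (d - d mod p)"
        using mod_less_divisor[OF p, of d] mod_less_eq_dividend[of d p] by linarith
      moreover have "p dvd d - d mod p" by (rule dvd_minus_mod)
      ultimately show ?thesis by (metis dvd_add_triv_left_iff)
    qed
    then show "n \<in> pair_residues d p"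
      using n p \<open>d mod p \<noteq> 0\<close> by (auto simp: pair_residues_def)
  qed
  have "pair_residues d p = {0, p - d mod p}" using mem by blast
  then show ?thesis using False mod_less_divisor[OF p, of d] by simp
qed

text \<open>
  The square of the one-dimensional sum bounds \<open>(ln y)\<^sup>2 / 4\<close> and has local factors \<open>2 / p + 1 / p\<^sup>2\<close>.
  For \<open>p\<close> not dividing \<open>d\<close> this is at most the sieve factor \<open>2 / (p - 2)\<close>; evenness of \<open>d\<close> keeps
  \<open>p = 2\<close>, where that factor is meaningless, out of this case.  For \<open>p\<close> dividing \<open>d\<close> it is at most
  \<open>2 h + h\<^sup>2\<close> with \<open>h = 1 / (p - 1)\<close>, and the surplus over \<open>h\<close> is paid for by \<open>totient_ratio d\<close>.
\<close>

lemma sieve_density_lower_bound: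
  assumes d: "even d" "d > 0" and y: "y \<ge> 1"
  shows "(ln y)\<^sup>2 \<le> 4 * totient_ratio d *
    (\<Sum>S\<in>prime_sets (y\<^sup>2). \<Prod>p\<in>S. if p dvd d then 1 / (real p - 1) else 2 / (real p - 2))"
proof -
  define h where "h p = (if p dvd d then 1 / (real p - 1) else 2 / (real p - 2))" for p
  have ge3: "p \<ge> 3" if "prime p" "\<not> p dvd d" for p
    using prime_ge_2_nat[OF that(1)] that(2) d by (cases "p = 2") auto
  have h: "h p \<ge> 0" if "prime p" for p
    using prime_ge_2_nat[OF that] ge3[OF that] by (auto simp: h_def)
  have "0 \<le> ln y" using y by simp
  then have "(ln y)\<^sup>2 \<le> (2 * (\<Sum>S\<in>prime_sets y. \<Prod>p\<in>S. 1 / real p))\<^sup>2"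
    by (intro power_mono ln_le_sum_prime_sets y)
  also have "\<dots> = 4 * (\<Sum>S\<in>prime_sets y. \<Prod>p\<in>S. 1 / real p)\<^sup>2" by (simp add: power_mult_distrib)
  also have "(\<Sum>S\<in>prime_sets y. \<Prod>p\<in>S. 1 / real p)\<^sup>2 \<le>
      (\<Sum>E\<in>prime_sets (y\<^sup>2). \<Prod>p\<in>E. 2 * (1 / real p) + (1 / real p)\<^sup>2)"
    by (rule sum_prime_sets_squared_le) (use y in auto)
  also have "\<dots> \<le> (\<Sum>E\<in>prime_sets (y\<^sup>2). \<Prod>p\<in>E. if p \<in> prime_factors d then 2 * h p + (h p)\<^sup>2 else h p)"
  proof (intro sum_mono prod_mono conjI)
    fix E p assume "E \<in> prime_sets (y\<^sup>2)" "p \<in> E"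
    then have p: "prime p" by (auto simp: prime_sets_def)
    have p2: "p \<ge> 2" using p by (rule prime_ge_2_nat)
    show "2 * (1 / real p) + (1 / real p)\<^sup>2 \<le> (if p \<in> prime_factors d then 2 * h p + (h p)\<^sup>2 else h p)"
    proof (cases "p dvd d")
      case True
      then have "1 / real p \<le> h p" using p2 by (simp add: h_def frac_le)
      then have "2 * (1 / real p) + (1 / real p)\<^sup>2 \<le> 2 * h p + (h p)\<^sup>2"
        by (intro add_mono power_mono) auto
      then show ?thesis using True p d by (simp add: in_prime_factors_iff)
    next
      case False
      then have "real p \<ge> 3" using ge3[OF p] by simp
      then have "2 * (1 / real p) + (1 / real p)\<^sup>2 \<le> 2 / (real p - 2)"
        by (simp add: field_simps power2_eq_square)
      then show ?thesis using False by (simp add: h_def in_prime_factors_iff)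
    qed
  qed auto
  also have "\<dots> \<le> (\<Prod>p\<in>prime_factors d. 1 + h p) * (\<Sum>E\<in>prime_sets (y\<^sup>2). prod h E)"
    by (rule sum_prime_sets_absorb_factor) (use h in \<open>auto simp: prime_sets_def in_prime_factors_iff\<close>)
  also have "(\<Prod>p\<in>prime_factors d. 1 + h p) = totient_ratio d"
    unfolding totient_ratio_def by (rule prod.cong) (auto simp: h_def in_prime_factors_iff)
  finally show ?thesis by (simp add: h_def mult_ac)
qed

text \<open>
  If \<open>q\<close> and \<open>q + d\<close> are primes and \<open>q > y\<^sup>2\<close>, then neither is divisible by a prime up to the sieve
  level \<open>y\<^sup>2\<close>, so \<open>q\<close> survives; the remaining \<open>q \<le> y\<^sup>2\<close> are counted trivially.
\<close>

lemma card_prime_pairs_sieve: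
  assumes d: "even d" "d > 0" and y: "y > 1"
  shows "real (card {q. q < N \<and> prime q \<and> prime (q + d)}) \<le>
    4 * totient_ratio d * real N / (ln y)\<^sup>2 + y ^ 8 + y\<^sup>2"
proof -
  define \<S> where "\<S> = prime_sets (y\<^sup>2)"
  define G where "G = (\<Sum>S\<in>\<S>. \<Prod>p\<in>S. real (card (pair_residues d p)) / (real p - real (card (pair_residues d p))))"
  define T where "T = {n. n < N \<and> (\<forall>S\<in>\<S>. \<forall>p\<in>S. n mod p \<notin> pair_residues d p)}"
  have card_bounds: "0 < card (pair_residues d p) \<and> card (pair_residues d p) < p" if p: "prime p" for p
  proof -
    have "p \<ge> 2" using p by (rule prime_ge_2_nat)
    moreover have "p \<noteq> 2" if "\<not> p dvd d" using that d by auto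
    ultimately show ?thesis by (auto simp: card_pair_residues[OF p])
  qed
  have prime: "prime p" if "S \<in> \<S>" "p \<in> S" for S p
    using that by (auto simp: \<S>_def prime_sets_def)
  have fin: "finite \<S>" unfolding \<S>_def by (rule finite_prime_sets)
  have "real (card T) \<le> real N / G + (\<Sum>S\<in>\<S>. real (\<Prod>S))\<^sup>2"
    unfolding T_def G_def
  proof (rule selberg_sieve[OF fin])
    show "finite S" if "S \<in> \<S>" for S using that by (simp add: \<S>_def prime_sets_def)
    show "{} \<in> \<S>" using y by (simp add: \<S>_def prime_sets_def)
    show "S \<in> \<S>" if "T \<in> \<S>" "S \<subseteq> T" for S T
      using that prime_sets_subset unfolding \<S>_def by blast
    show "prime p" if "S \<in> \<S>" "p \<in> S" for S p using prime[OF that] .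
    show "pair_residues d p \<subseteq> {..<p}" for p by (auto simp: pair_residues_def)
    show "0 < card (pair_residues d p) \<and> card (pair_residues d p) < p" if "S \<in> \<S>" "p \<in> S" for S p
      using card_bounds[OF prime[OF that]] .
  qed
  moreover have "(\<Sum>S\<in>\<S>. real (\<Prod>S))\<^sup>2 \<le> ((y\<^sup>2)\<^sup>2)\<^sup>2"
    unfolding \<S>_def by (intro power_mono sum_prod_prime_sets_le sum_nonneg) (auto intro: prod_nonneg)
  moreover have "((y\<^sup>2)\<^sup>2)\<^sup>2 = y ^ 8" by (simp add: power_mult[symmetric])
  moreover have "real N / G \<le> 4 * totient_ratio d * real N / (ln y)\<^sup>2"
  proof -
    have "G = (\<Sum>S\<in>\<S>. \<Prod>p\<in>S. if p dvd d then 1 / (real p - 1) else 2 / (real p - 2))"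
      unfolding G_def by (intro sum.cong prod.cong refl) (auto simp: card_pair_residues prime)
    then have le: "(ln y)\<^sup>2 \<le> 4 * totient_ratio d * G"
      using sieve_density_lower_bound[OF d, of y] y by (simp add: \<S>_def)
    have pos: "(ln y)\<^sup>2 > 0" using y by simp
    then have "4 * totient_ratio d * G > 0" using le by linarith
    then have "G > 0" using totient_ratio_ge_1[of d] by (simp add: zero_less_mult_iff)
    then have "real N * (ln y)\<^sup>2 \<le> real N * (4 * totient_ratio d * G)"
      by (intro mult_left_mono le) auto
    then show ?thesis using pos \<open>G > 0\<close> by (simp add: field_simps)
  qed
  moreover have "real (card {q. q < N \<and> prime q \<and> prime (q + d)}) \<le> real (card T) + y\<^sup>2"
  proof -
    have "{q. q < N \<and> prime q \<and> prime (q + d)} \<subseteq> T \<union> {1..nat \<lfloor>y\<^sup>2\<rfloor>}"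
    proof
      fix q assume q: "q \<in> {q. q < N \<and> prime q \<and> prime (q + d)}"
      show "q \<in> T \<union> {1..nat \<lfloor>y\<^sup>2\<rfloor>}"
      proof (cases "real q \<le> y\<^sup>2")
        case True
        then have "q \<le> nat \<lfloor>y\<^sup>2\<rfloor>" by (rule le_nat_floor)
        then show ?thesis using q prime_gt_0_nat[of q] by auto
      next
        case False
        have "q mod p \<notin> pair_residues d p" if S: "S \<in> \<S>" "p \<in> S" for S p
        proof
          assume mem: "q mod p \<in> pair_residues d p"
          have p: "prime p" by (rule prime[OF S])
          have "real p \<le> y\<^sup>2" using prime_sets_member_le S unfolding \<S>_def by blast
          then have "p < q" using False by linarith
          have "p dvd q \<or> p dvd q + d"
            using mem unfolding pair_residues_def by (auto simp: mod_eq_0_iff_dvd) (metis mod_add_left_eq mod_eq_0_iff_dvd)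
          then have "p = q \<or> p = q + d" using q p primes_dvd_imp_eq by blast
          then show False using \<open>p < q\<close> by auto
        qed
        then show ?thesis using q by (auto simp: T_def)
      qed
    qed
    then have "card {q. q < N \<and> prime q \<and> prime (q + d)} \<le> card (T \<union> {1..nat \<lfloor>y\<^sup>2\<rfloor>})"
      by (intro card_mono) (auto simp: T_def)
    also have "\<dots> \<le> card T + nat \<lfloor>y\<^sup>2\<rfloor>" using card_Un_le[of T "{1..nat \<lfloor>y\<^sup>2\<rfloor>}"] by simp
    finally have "real (card {q. q < N \<and> prime q \<and> prime (q + d)}) \<le> real (card T) + real (nat \<lfloor>y\<^sup>2\<rfloor>)"
      by (simp only: of_nat_le_iff of_nat_add[symmetric])
    also have "real (nat \<lfloor>y\<^sup>2\<rfloor>) \<le> y\<^sup>2" by (rule of_nat_floor) simp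
    finally show ?thesis by simp
  qed
  ultimately show ?thesis by linarith
qed

text \<open>
  The choice \<open>y = N powr (1 / 16)\<close> makes the sieve remainder \<open>y ^ 8\<close> equal to \<open>sqrt N\<close>, which is
  negligible against \<open>N / (ln N)\<^sup>2\<close>.
\<close>

lemma card_prime_pairs_le:
  assumes d: "even d" "d > 0" and N: "N \<ge> 2"
  shows "real (card {q. q < N \<and> prime q \<and> prime (q + d)}) \<le>
    1056 * totient_ratio d * real N / (ln (real N))\<^sup>2"
proof -
  define x where "x = real N"
  define y where "y = x powr (1 / 16)"
  have x: "x \<ge> 2" using N by (simp add: x_def)
  have y1: "y > 1" using x by (simp add: y_def)
  have lny: "ln y = ln x / 16" using x by (simp add: y_def ln_powr)
  have "y ^ 8 = (x powr (1/16)) powr 8" using x by (simp add: y_def powr_numeral)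
  then have y8: "y ^ 8 = sqrt x" using x by (simp add: powr_powr powr_half_sqrt)
  have y2: "y\<^sup>2 \<le> y ^ 8" using y1 by (intro power_increasing) auto
  have lnx: "ln x > 0" using x by simp
  have "ln x = 4 * ln (x powr (1/4))" using x by (simp add: ln_powr)
  also have "\<dots> \<le> 4 * x powr (1/4)" using x by (intro mult_left_mono less_imp_le[OF ln_less_self]) auto
  finally have "(ln x)\<^sup>2 \<le> (4 * x powr (1/4))\<^sup>2" using lnx by (intro power_mono) auto
  also have "\<dots> = 16 * (x powr (1/4)) powr 2" using x by (simp add: power_mult_distrib powr_numeral)
  also have "\<dots> = 16 * sqrt x" using x by (simp add: powr_powr powr_half_sqrt)
  finally have "(ln x)\<^sup>2 * sqrt x \<le> 16 * sqrt x * sqrt x" using x by (intro mult_right_mono) auto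
  then have "(ln x)\<^sup>2 * sqrt x \<le> 16 * x" using x by (simp add: mult.assoc)
  then have sq: "sqrt x \<le> 16 * x / (ln x)\<^sup>2" using lnx by (simp add: field_simps)
  have "16 * x / (ln x)\<^sup>2 * 1 \<le> 16 * x / (ln x)\<^sup>2 * totient_ratio d"
    using x by (intro mult_left_mono totient_ratio_ge_1) auto
  then have sq: "sqrt x \<le> 16 * x / (ln x)\<^sup>2 * totient_ratio d" using sq by linarith
  have "real (card {q. q < N \<and> prime q \<and> prime (q + d)}) \<le> 4 * totient_ratio d * x / (ln y)\<^sup>2 + y ^ 8 + y\<^sup>2"
    unfolding x_def by (rule card_prime_pairs_sieve[OF d y1])
  also have "\<dots> \<le> 1024 * totient_ratio d * x / (ln x)\<^sup>2 + 2 * sqrt x"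
    using y2 y8 by (simp add: lny power2_eq_square)
  also have "\<dots> \<le> 1024 * totient_ratio d * x / (ln x)\<^sup>2 + 2 * (16 * x / (ln x)\<^sup>2 * totient_ratio d)"
    by (intro add_left_mono mult_left_mono sq) auto
  also have "\<dots> = 1056 * totient_ratio d * x / (ln x)\<^sup>2"
    by (simp add: add_divide_distrib[symmetric])
  finally show ?thesis by (simp add: x_def)
qed

section \<open>Chebyshev's bound for the nth prime\<close>

text \<open>
  This is the partial fraction expansion of \<open>n! / (x (x + 1) \<dots> (x + n))\<close>, equivalently the value
  of the integral of \<open>t\<^sup>x\<^sup>-\<^sup>1 (1 - t)\<^sup>n\<close> over \<open>[0, 1]\<close>.  By Pascal's rule the left-hand side for \<open>n + 1\<close>
  is the difference of its values for \<open>n\<close> at \<open>x\<close> and \<open>x + 1\<close>.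
\<close>

lemma alternating_binomial_sum_eq:
  assumes "(x::real) > 0"
  shows "(\<Sum>k\<le>n. (-1) ^ k * real (n choose k) / (x + real k)) = fact n / (\<Prod>i\<le>n. x + real i)"
  using assms
proof (induction n arbitrary: x)
  case (Suc n)
  let ?S = "\<lambda>n x. \<Sum>k\<le>n. (-1) ^ k * real (n choose k) / (x + real k)"
  have "?S (Suc n) x = 1 / x + (\<Sum>k\<le>n. (-1) ^ Suc k * real (Suc n choose Suc k) / (x + real (Suc k)))"
    by (subst sum.atMost_Suc_shift) simp
  also have "(\<Sum>k\<le>n. (-1) ^ Suc k * real (Suc n choose Suc k) / (x + real (Suc k))) =
      (\<Sum>k\<le>n. (-1) ^ Suc k * real (n choose Suc k) / (x + real (Suc k))) - ?S n (x + 1)"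
    unfolding sum_subtractf[symmetric]
  proof (rule sum.cong[OF refl])
    fix k
    have "x + real (Suc k) = x + 1 + real k" by simp
    then show "(-1) ^ Suc k * real (Suc n choose Suc k) / (x + real (Suc k)) =
      (-1) ^ Suc k * real (n choose Suc k) / (x + real (Suc k)) - (-1) ^ k * real (n choose k) / (x + 1 + real k)"
      by (simp only: binomial_Suc_Suc of_nat_add power_Suc) (simp add: field_simps diff_divide_distrib add_divide_distrib)
  qed
  also have "1 / x + ((\<Sum>k\<le>n. (-1) ^ Suc k * real (n choose Suc k) / (x + real (Suc k))) - ?S n (x + 1)) =
      (\<Sum>k\<le>Suc n. (-1) ^ k * real (n choose k) / (x + real k)) - ?S n (x + 1)"
    using sum.atMost_Suc_shift[of "\<lambda>k. (-1) ^ k * real (n choose k) / (x + real k)" n] by simp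
  also have "(\<Sum>k\<le>Suc n. (-1) ^ k * real (n choose k) / (x + real k)) = ?S n x"
    by simp
  also have "?S n x - ?S n (x + 1) = fact n / (\<Prod>i\<le>n. x + real i) - fact n / (\<Prod>i\<le>n. (x + 1) + real i)"
    using Suc.IH[of x] Suc.IH[of "x + 1"] Suc.prems by simp
  also have "\<dots> = fact (Suc n) / (\<Prod>i\<le>Suc n. x + real i)"
  proof -
    define Q where "Q = (\<Prod>i<n. x + 1 + real i)"
    have Q: "Q > 0" unfolding Q_def using Suc.prems by (intro prod_pos) auto
    have 1: "(\<Prod>i\<le>n. x + real i) = x * Q"
      unfolding Q_def lessThan_Suc_atMost[symmetric] by (subst prod.lessThan_Suc_shift) (simp add: algebra_simps)
    have 2: "(\<Prod>i\<le>n. (x + 1) + real i) = Q * (x + 1 + real n)"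
      unfolding Q_def lessThan_Suc_atMost[symmetric] by (subst prod.lessThan_Suc) simp
    have 3: "(\<Prod>i\<le>Suc n. x + real i) = x * Q * (x + 1 + real n)"
      using 1 by (simp add: algebra_simps)
    define s where "s = x + 1 + real n"
    have s: "s > 0" "s - x = real (Suc n)" using Suc.prems by (simp_all add: s_def)
    have "fact n / (x * Q) - fact n / (Q * s) = fact n * (s - x) / (x * Q * s)"
      using Q s(1) Suc.prems by (simp add: field_simps)
    then show ?thesis unfolding 1 2 3 s_def[symmetric] s(2) by simp
  qed
  finally show ?case .
qed simp

text \<open>
  This is the least common multiple of \<open>1, \<dots>, N\<close>.  The product form makes the upper bound
  \<open>N ^ \<pi>(N)\<close> immediate.
\<close>

definition prime_power_product :: "nat \<Rightarrow> nat" where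
  "prime_power_product N = (\<Prod>p | prime p \<and> p \<le> N. p ^ Max {e. p ^ e \<le> N})"

lemma prime_power_product_pos: "prime_power_product N > 0"
  unfolding prime_power_product_def by (rule prod_pos) (auto dest: prime_gt_0_nat)

lemma finite_exponents:
  assumes "p \<ge> (2::nat)"
  shows "finite {e. p ^ e \<le> N}"
proof (rule finite_subset)
  show "{e. p ^ e \<le> N} \<subseteq> {..N}"
  proof
    fix e assume "e \<in> {e. p ^ e \<le> N}"
    moreover have "e < p ^ e" using assms by (intro power_gt_expt) auto
    ultimately show "e \<in> {..N}" by simp
  qed
qed simp

lemma dvd_prime_power_product:
  assumes "1 \<le> m" "m \<le> N"
  shows "m dvd prime_power_product N"
proof -
  have "m = (\<Prod>p\<in>prime_factors m. p ^ multiplicity p m)"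
    using assms by (intro prime_factorization_nat) auto
  also have "\<dots> dvd prime_power_product N"
    unfolding prime_power_product_def
  proof (rule prod_dvd_prod_subset2)
    show "prime_factors m \<subseteq> {p. prime p \<and> p \<le> N}"
      using assms dvd_imp_le[of _ m] by (auto simp: in_prime_factors_iff intro: order_trans)
    fix p assume "p \<in> prime_factors m"
    then have p: "prime p" by auto
    have "p ^ multiplicity p m \<le> m" using assms by (intro dvd_imp_le multiplicity_dvd) auto
    then have "multiplicity p m \<le> Max {e. p ^ e \<le> N}"
      using assms by (intro Max_ge finite_exponents prime_ge_2_nat p) auto
    then show "p ^ multiplicity p m dvd p ^ Max {e. p ^ e \<le> N}" by (rule le_imp_power_dvd)
  qed simp
  finally show ?thesis .
qed

lemma prime_power_product_le:
  assumes "N \<ge> 1"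
  shows "prime_power_product N \<le> N ^ card {p. prime p \<and> p \<le> N}"
proof -
  have "prime_power_product N \<le> (\<Prod>p | prime p \<and> p \<le> N. N)"
    unfolding prime_power_product_def
  proof (rule prod_mono)
    fix p assume p: "p \<in> {p. prime p \<and> p \<le> N}"
    have "Max {e. p ^ e \<le> N} \<in> {e. p ^ e \<le> N}"
      using p assms by (intro Max_in finite_exponents prime_ge_2_nat) (auto intro!: exI[of _ 0])
    then show "0 \<le> p ^ Max {e. p ^ e \<le> N} \<and> p ^ Max {e. p ^ e \<le> N} \<le> N" by simp
  qed
  then show ?thesis by simp
qed

text \<open>
  The alternating sum \<open>I\<close> at \<open>x = n + 1\<close> has denominators \<open>n + 1, \<dots>, 2 n + 1\<close>, all dividing
  \<open>M = prime_power_product (2 n + 1)\<close>.  So \<open>M * I\<close> is a positive integer and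
  \<open>M \<ge> 1 / I = (2 n + 1) * ((2 n) choose n) \<ge> 4 ^ n\<close>.
\<close>

lemma four_power_le_prime_power_product: "4 ^ n \<le> prime_power_product (2 * n + 1)"
proof (cases "n = 0")
  case False
  define M where "M = prime_power_product (2 * n + 1)"
  define I where "I = (\<Sum>k\<le>n. (-1) ^ k * real (n choose k) / (real (n + 1) + real k))"
  have I: "I = fact n / (\<Prod>i\<le>n. real (n + 1) + real i)"
    unfolding I_def by (rule alternating_binomial_sum_eq) simp
  have P: "(\<Prod>i\<le>n. real (n + 1) + real i) = fact (2 * n + 1) / fact n"
  proof -
    have "(\<Prod>i\<le>m. real (n + 1) + real i) = fact (n + 1 + m) / fact n" for m
    proof (induction m)
      case (Suc m)
      have "(\<Prod>i\<le>Suc m. real (n + 1) + real i) = fact (n + 1 + m) / fact n * real (n + 1 + Suc m)"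
        unfolding prod.atMost_Suc Suc by simp
      also have "\<dots> = fact (n + 1 + Suc m) / fact n"
        by (simp only: add_Suc_right fact_Suc times_divide_eq_left times_divide_eq_right mult.commute)
      finally show ?case .
    qed simp
    from this[of n] show ?thesis by (simp only: mult_2 add_ac)
  qed
  have binom: "real ((2 * n) choose n) = fact (2 * n) / (fact n * fact n)"
    using binomial_fact[of n "2 * n", where ?'a = real] by (simp add: mult_2)
  have fact_odd: "fact (2 * n + 1) = real (2 * n + 1) * (fact (2 * n) :: real)"
    by (simp only: Suc_eq_plus1[symmetric] fact_Suc)
  have invI: "1 / I = real (2 * n + 1) * real ((2 * n) choose n)"
    unfolding I P binom fact_odd by simp
  have Ipos: "I > 0" 
    unfolding I P by simp
  have "real M * I \<in> \<int>"
    unfolding I_def sum_distrib_left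
  proof (rule Ints_sum)
    fix k assume "k \<in> {..n}"
    then have "n + 1 + k dvd M" unfolding M_def by (intro dvd_prime_power_product) auto
    then obtain r where r: "M = (n + 1 + k) * r" by auto
    have "real M * ((-1) ^ k * real (n choose k) / (real (n + 1) + real k)) = (-1) ^ k * real (n choose k) * real r"
      unfolding r by (simp add: field_simps)
    then show "real M * ((-1) ^ k * real (n choose k) / (real (n + 1) + real k)) \<in> \<int>" by simp
  qed
  moreover have "real M * I > 0"
  proof -
    have "M > 0" unfolding M_def by (rule prime_power_product_pos)
    then show ?thesis using Ipos by simp
  qed
  ultimately have "real M * I \<ge> 1" by (auto elim!: Ints_cases)
  then have "1 / I \<le> real M" using Ipos by (simp add: field_simps)
  moreover have "(4::real) ^ n \<le> real (2 * n + 1) * real ((2 * n) choose n)"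
  proof -
    have "(4::real) ^ n = 2 * real n * (4 ^ n / (2 * real n))" using False by simp
    also have "\<dots> \<le> real (2 * n + 1) * real ((2 * n) choose n)"
      using central_binomial_lower_bound[of n] False by (intro mult_mono) auto
    finally show ?thesis .
  qed
  ultimately have "(4::real) ^ n \<le> real M" unfolding invI by (rule order_trans[rotated])
  then have "real (4 ^ n) \<le> real M" by (simp only: of_nat_power of_nat_numeral)
  then show ?thesis unfolding M_def by (simp only: of_nat_le_iff)
qed (use prime_power_product_pos[of 1] in simp)

lemma prime_count_lower_bound:
  assumes "N \<ge> 3"
  shows "real N \<le> 5 * real (card {p. prime p \<and> p \<le> N}) * ln (real N)"
proof -
  define n where "n = (N - 1) div 2"
  have n: "2 * n + 1 \<le> N" "N \<le> 2 * n + 2" using assms by (auto simp: n_def)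
  have sub: "{p. prime p \<and> p \<le> 2 * n + 1} \<subseteq> {p. prime p \<and> p \<le> N}" using n by auto
  have "4 ^ n \<le> (2 * n + 1) ^ card {p. prime p \<and> p \<le> 2 * n + 1}"
    using four_power_le_prime_power_product prime_power_product_le by (rule order_trans) simp
  also have "\<dots> \<le> N ^ card {p. prime p \<and> p \<le> 2 * n + 1}" using n by (intro power_mono) auto
  also have "\<dots> \<le> N ^ card {p. prime p \<and> p \<le> N}"
    using assms sub by (intro power_increasing card_mono) auto
  finally have "real (4 ^ n) \<le> real (N ^ card {p. prime p \<and> p \<le> N})" by (simp only: of_nat_le_iff)
  then have "ln (4 ^ n) \<le> ln (real N ^ card {p. prime p \<and> p \<le> N})" using assms by simp
  then have "real n * ln 4 \<le> real (card {p. prime p \<and> p \<le> N}) * ln (real N)"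
    using assms by (simp add: ln_realpow)
  moreover have "ln (4::real) = 2 * ln 2" using ln_realpow[of 2 2] by simp
  then have "ln (4::real) \<ge> 4 / 3" using ln2_ge_two_thirds by simp
  then have "real n * (4 / 3) \<le> real n * ln 4" by (intro mult_left_mono) auto
  moreover have "real N \<le> 2 * real n + 2" "real N \<ge> 3" using n assms by linarith+
  ultimately show ?thesis by linarith
qed

lemma prime_nth_prime: "prime (nth_prime n)"
  unfolding nth_prime_def using enumerate_in_set[OF primes_infinite] by simp

lemma card_primes_le_nth_prime:
  assumes "n \<ge> 1"
  shows "card {p. prime p \<and> p \<le> nth_prime n} \<le> n"
proof -
  have sub: "{p. prime p \<and> p \<le> nth_prime n} \<subseteq> enumerate {p. prime p} ` {..<n}"
  proof
    fix p assume p: "p \<in> {p. prime p \<and> p \<le> nth_prime n}"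
    then obtain j where j: "enumerate {p. prime p} j = p" using enumerate_Ex[OF primes_infinite, of p] by auto
    have "j < n"
    proof (rule ccontr)
      assume "\<not> j < n"
      then have "n - 1 < j" using assms by simp
      then have "nth_prime n < p"
        unfolding nth_prime_def j[symmetric] by (rule enumerate_mono[OF _ primes_infinite])
      then show False using p by simp
    qed
    then show "p \<in> enumerate {p. prime p} ` {..<n}" using j by auto
  qed
  have "card {p. prime p \<and> p \<le> nth_prime n} \<le> card (enumerate {p::nat. prime p} ` {..<n})"
    by (intro card_mono sub) auto
  also have "\<dots> \<le> n" using card_image_le[of "{..<n}" "enumerate {p::nat. prime p}"] by simp
  finally show ?thesis .
qed

lemma nth_prime_gt: "n \<ge> 1 \<Longrightarrow> nth_prime n > n"
proof (induction n rule: dec_induct)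
  case base
  show ?case using nth_prime_1 by simp
next
  case (step n)
  then show ?case using nth_prime_strict_mono[of n "Suc n"] by simp
qed

text \<open>
  For \<open>x = nth_prime n\<close> the lower bound for the number of primes reads \<open>x \<le> 5 n ln x\<close>.  The trivial
  \<open>ln x \<le> 2 sqrt x\<close> first gives \<open>x \<le> 100 n\<^sup>2\<close>, hence \<open>ln x = O(ln n)\<close>, which is then fed back.
\<close>

lemma nth_prime_le:
  assumes "n \<ge> 2"
  shows "real (nth_prime n) \<le> 45 * real n * ln (real n)"
proof -
  define x where "x = real (nth_prime n)"
  have x3: "nth_prime n \<ge> 3" using nth_prime_gt[of n] assms by simp
  have "x \<le> 5 * real (card {p. prime p \<and> p \<le> nth_prime n}) * ln x"
    unfolding x_def by (rule prime_count_lower_bound[OF x3])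
  also have "\<dots> \<le> 5 * real n * ln x"
    using card_primes_le_nth_prime[of n] assms x3 by (intro mult_right_mono) (auto simp: x_def)
  finally have le: "x \<le> 5 * real n * ln x" .
  have x: "x \<ge> 3" using x3 by (simp add: x_def)
  have "ln x = 2 * ln (sqrt x)" using x by (simp add: ln_sqrt)
  also have "\<dots> \<le> 2 * sqrt x" using x less_imp_le[OF ln_less_self[of "sqrt x"]] by simp
  finally have "5 * real n * ln x \<le> 5 * real n * (2 * sqrt x)" by (intro mult_left_mono) auto
  then have "sqrt x * sqrt x \<le> 10 * real n * sqrt x" using le x by (simp add: mult.assoc)
  then have "sqrt x \<le> 10 * real n" by (rule mult_right_le_imp_le) (use x in simp)
  then have "(sqrt x)\<^sup>2 \<le> (10 * real n)\<^sup>2" using x by (intro power_mono) auto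
  then have "x \<le> 100 * (real n)\<^sup>2" using x by (simp add: power_mult_distrib)
  then have "ln x \<le> ln (100 * (real n)\<^sup>2)" using x assms by (subst ln_le_cancel_iff) auto
  also have "\<dots> = ln 100 + 2 * ln (real n)" using assms by (simp add: ln_mult ln_realpow)
  also have "ln (100::real) \<le> ln (2 ^ 7)" by (subst ln_le_cancel_iff) auto
  also have "ln ((2::real) ^ 7) = 7 * ln 2" by (subst ln_realpow) simp_all
  also have "ln (2::real) \<le> ln (real n)" using assms by simp
  finally have "5 * real n * ln x \<le> 5 * real n * (9 * ln (real n))" by (intro mult_left_mono) auto
  then show ?thesis using le by (simp add: x_def)
qed

section \<open>Reciprocals of prime gaps on average\<close>

lemma even_prime_gap:
  assumes "n \<ge> 2"
  shows "even (prime_gap n)"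
proof -
  have "odd (nth_prime m)" if "m \<ge> 2" for m
    using nth_prime_gt[of m] that by (intro prime_odd_nat prime_nth_prime) auto
  then show ?thesis using assms by (simp add: prime_gap_def)
qed

text \<open>
  Gaps above \<open>D = \<lfloor>ln M\<rfloor>\<close> contribute at most \<open>1 / ln M\<close> each.  An index with gap \<open>d \<le> D\<close> gives a pair
  of primes of difference \<open>d\<close> below \<open>N = O(M ln M)\<close>, so the pair bound and the average of
  \<open>totient_ratio\<close> apply.  The first gap, the only odd one, is split off.
\<close>

lemma sum_recip_prime_gap_le:
  assumes M: "M \<ge> 3"
  shows "(\<Sum>n=1..M. 1 / real (prime_gap n)) \<le> 200000 * (1 + ln (ln (real M))) * real M / ln (real M)"
proof -
  define D where "D = nat \<lfloor>ln (real M)\<rfloor>"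
  define N where "N = nth_prime M + 1"
  define A where "A = {n \<in> {2..M}. prime_gap n \<le> D}"
  define L where "L = ln (real M)"
  have "exp 1 \<le> real M" using exp_le M by linarith
  then have L1: "L \<ge> 1" unfolding L_def using M by (subst ln_ge_iff) auto
  have gap_pos: "prime_gap n > 0" if "n \<ge> 1" for n using prime_gap_pos[OF that] .
  have NM: "N \<ge> M" using nth_prime_gt[of M] M by (simp add: N_def)
  have N2: "N \<ge> 2" using NM M by simp
  \<comment> \<open>Here 45 becomes 46 because N exceeds the Mth prime by one.\<close>
  have "1 * 1 \<le> real M * L" using M L1 by (intro mult_mono) auto
  then have N_le: "real N \<le> 46 * (real M * L)"
    using nth_prime_le[of M] M by (simp add: N_def L_def)
  have "L \<le> ln (real N)" unfolding L_def using NM M by simp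
  then have "L\<^sup>2 \<le> (ln (real N))\<^sup>2" using L1 by (intro power_mono) auto
  then have "real N / (ln (real N))\<^sup>2 \<le> 46 * (real M * L) / L\<^sup>2"
    using N_le L1 M by (intro frac_le) auto
  then have ratio: "real N / (ln (real N))\<^sup>2 \<le> 46 * (real M / L)"
    using L1 by (simp add: power2_eq_square)
  have D1: "D \<ge> 1" using L1 by (simp add: D_def L_def le_nat_iff)
  have DL: "real D \<le> L" using L1 unfolding D_def L_def by (intro of_nat_floor) simp
  have LD: "L \<le> real (D + 1)" unfolding D_def L_def using L1 by linarith

  have large: "(\<Sum>n\<in>{2..M} - A. 1 / real (prime_gap n)) \<le> real M / L"
  proof -
    have "(\<Sum>n\<in>{2..M} - A. 1 / real (prime_gap n)) \<le> (\<Sum>n\<in>{2..M} - A. 1 / L)"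
    proof (rule sum_mono)
      fix n assume "n \<in> {2..M} - A"
      then have "D + 1 \<le> prime_gap n" by (auto simp: A_def)
      then have "real (D + 1) \<le> real (prime_gap n)" by (simp only: of_nat_le_iff)
      then show "1 / real (prime_gap n) \<le> 1 / L" using LD L1 by (intro frac_le) auto
    qed
    also have "\<dots> \<le> real M / L"
    proof -
      have "card ({2..M} - A) \<le> card {2..M}" by (intro card_mono) auto
      also have "\<dots> \<le> M" by simp
      finally show ?thesis using L1 by (simp add: divide_right_mono)
    qed
    finally show ?thesis .
  qed

  have count: "real (card {n \<in> A. prime_gap n = d}) \<le> 1056 * totient_ratio d * (46 * (real M / L))"
    if d: "d \<in> {1..D}" for d
  proof (cases "even d")
    case True
    have "nth_prime ` {n \<in> A. prime_gap n = d} \<subseteq> {q. q < N \<and> prime q \<and> prime (q + d)}"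
    proof
      fix q assume "q \<in> nth_prime ` {n \<in> A. prime_gap n = d}"
      then obtain n where n: "q = nth_prime n" "2 \<le> n" "n \<le> M" "prime_gap n = d" by (auto simp: A_def)
      have "nth_prime n < nth_prime (n + 1)" using n by (intro nth_prime_strict_mono) auto
      then have "q + d = nth_prime (n + 1)" using n by (simp add: prime_gap_def)
      moreover have "q < N"
        using n nth_prime_strict_mono[of n M] by (cases "n = M") (auto simp: N_def)
      ultimately show "q \<in> {q. q < N \<and> prime q \<and> prime (q + d)}" using n prime_nth_prime by auto
    qed
    then have "card (nth_prime ` {n \<in> A. prime_gap n = d}) \<le> card {q. q < N \<and> prime q \<and> prime (q + d)}"
      by (intro card_mono) auto
    moreover have "inj_on nth_prime {n \<in> A. prime_gap n = d}"
    proof (rule linorder_inj_onI)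
      fix m n assume "m < n" "m \<in> {n \<in> A. prime_gap n = d}"
      then show "nth_prime m \<noteq> nth_prime n" using nth_prime_strict_mono[of m n] by (auto simp: A_def)
    qed auto
    ultimately have "card {n \<in> A. prime_gap n = d} \<le> card {q. q < N \<and> prime q \<and> prime (q + d)}"
      by (simp add: card_image)
    then have "real (card {n \<in> A. prime_gap n = d}) \<le> real (card {q. q < N \<and> prime q \<and> prime (q + d)})"
      by (simp only: of_nat_le_iff)
    also have "\<dots> \<le> 1056 * totient_ratio d * real N / (ln (real N))\<^sup>2"
      using True d by (intro card_prime_pairs_le N2) auto
    also have "\<dots> = 1056 * totient_ratio d * (real N / (ln (real N))\<^sup>2)" by simp
    also have "\<dots> \<le> 1056 * totient_ratio d * (46 * (real M / L))"
      using totient_ratio_ge_1[of d] by (intro mult_left_mono ratio) auto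
    finally show ?thesis .
  next
    case False
    then have "{n \<in> A. prime_gap n = d} = {}" using even_prime_gap by (auto simp: A_def)
    then have "real (card {n \<in> A. prime_gap n = d}) = 0" by (simp only: card.empty of_nat_0)
    also have "0 \<le> 1056 * totient_ratio d * (46 * (real M / L))"
      using totient_ratio_ge_1[of d] L1 by (intro mult_nonneg_nonneg) auto
    finally show ?thesis .
  qed

  have small: "(\<Sum>n\<in>A. 1 / real (prime_gap n)) \<le> 1056 * (46 * (real M / L)) * (3 * (1 + ln L))"
  proof -
    have "(\<Sum>n\<in>A. 1 / real (prime_gap n)) = (\<Sum>d\<in>{1..D}. \<Sum>n\<in>{n \<in> A. prime_gap n = d}. 1 / real (prime_gap n))"
    proof (rule sum.group[symmetric])
      show "prime_gap ` A \<subseteq> {1..D}" using gap_pos by (auto simp: A_def Suc_le_eq)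
    qed (auto simp: A_def)
    also have "\<dots> = (\<Sum>d\<in>{1..D}. real (card {n \<in> A. prime_gap n = d}) / real d)"
      by (rule sum.cong) simp_all
    also have "\<dots> \<le> (\<Sum>d\<in>{1..D}. 1056 * totient_ratio d * (46 * (real M / L)) / real d)"
      by (intro sum_mono divide_right_mono count) auto
    also have "\<dots> = 1056 * (46 * (real M / L)) * (\<Sum>d\<in>{1..D}. totient_ratio d / real d)"
      unfolding sum_distrib_left by (rule sum.cong) simp_all
    also have "\<dots> \<le> 1056 * (46 * (real M / L)) * (3 * (1 + ln L))"
    proof (rule mult_left_mono)
      have "(\<Sum>d=1..D. totient_ratio d / real d) \<le> exp 1 * (\<Sum>d=1..D. 1 / real d)"
        by (rule sum_totient_ratio_div_le)
      also have "(\<Sum>d=1..D. 1 / real d) = harm D" by (simp add: harm_def field_simps)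
      also have "harm D \<le> 1 + ln (real D)"
        using euler_mascheroni_sequence_decreasing[of 1 D] D1 by (simp add: harm_def)
      also have "ln (real D) \<le> ln L" using DL D1 by simp
      also have "exp 1 * (1 + ln L) \<le> 3 * (1 + ln L)" 
        using L1 by (intro mult_right_mono exp_le) auto
      finally show "(\<Sum>d=1..D. totient_ratio d / real d) \<le> 3 * (1 + ln L)" by simp
    qed (use L1 in simp)
    finally show ?thesis .
  qed

  have "(\<Sum>n=1..M. 1 / real (prime_gap n)) = 1 / real (prime_gap 1) + (\<Sum>n\<in>{2..M}. 1 / real (prime_gap n))"
    using M by (subst sum.atLeast_Suc_atMost) (auto simp: numeral_2_eq_2)
  moreover have "(\<Sum>n\<in>{2..M}. 1 / real (prime_gap n)) =
      (\<Sum>n\<in>{2..M} - A. 1 / real (prime_gap n)) + (\<Sum>n\<in>A. 1 / real (prime_gap n))"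
    by (rule sum.subset_diff) (auto simp: A_def)
  moreover have "1 / real (prime_gap 1) \<le> 1" using gap_pos[of 1] by simp
  moreover have "1 \<le> real M / L"
  proof -
    have "L \<le> real M" unfolding L_def using M by (intro less_imp_le ln_less_self) simp
    then show ?thesis using L1 by simp
  qed
  ultimately have total: "(\<Sum>n=1..M. 1 / real (prime_gap n)) \<le>
      real M / L + (real M / L + 1056 * (46 * (real M / L)) * (3 * (1 + ln L)))"
    using large small by linarith
  define Q where "Q = real M / L"
  have Q: "Q \<ge> 0" using L1 by (simp add: Q_def)
  have "2 * Q * 1 \<le> 2 * Q * (1 + ln L)" using L1 Q by (intro mult_left_mono) auto
  moreover have "Q * (1 + ln L) \<ge> 0" using Q L1 by simp
  ultimately have "Q + (Q + 1056 * (46 * Q) * (3 * (1 + ln L))) \<le> 200000 * (Q * (1 + ln L))"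
    by (simp add: algebra_simps)
  then show ?thesis using total by (simp add: Q_def L_def mult_ac)
qed

section \<open>Dyadic blocks\<close>

lemma powr_comparable:
  fixes a b q s :: real
  assumes "a > 0" "b > 0" "q > 0" "a \<le> q * b" "b \<le> q * a"
  shows "a powr s \<le> q powr \<bar>s\<bar> * b powr s"
proof (cases "s \<ge> 0")
  case True
  then have "a powr s \<le> (q * b) powr s" using assms by (intro powr_mono2) auto
  then show ?thesis using assms True by (simp add: powr_mult)
next
  case False
  then have "(q * a) powr s \<le> b powr s" using assms by (intro powr_mono2') auto
  then have "q powr (- s) * (q powr s * a powr s) \<le> q powr (- s) * b powr s"
    using assms by (intro mult_left_mono) (auto simp: powr_mult)
  moreover have "q powr (- s) * (q powr s * a powr s) = a powr s"
    using assms by (simp add: mult.assoc[symmetric] powr_add[symmetric])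
  ultimately show ?thesis using False by simp
qed

text \<open>
  Since \<open>ln n\<close> lies between \<open>k ln 2\<close> and \<open>(k + 1) ln 2\<close>, it lies between \<open>k powr (1 / 4)\<close> and \<open>k\<^sup>2\<close>
  for all \<open>k \<ge> 2\<close>.  These wide bounds hold from the first block on, where \<open>ln (ln n)\<close> can be less than
  half of \<open>ln k\<close>.
\<close>

lemma ln_ln_dyadic:
  assumes k: "k \<ge> (2::nat)" and n: "2 ^ k \<le> n" "n \<le> 2 ^ (k + 1)"
  shows "ln (real k) / 4 \<le> ln (ln (real n))" "ln (ln (real n)) \<le> 2 * ln (real k)"
proof -
  have rn: "2 ^ k \<le> real n" "real n \<le> 2 ^ (k + 1)"
    using n by (metis of_nat_le_iff of_nat_numeral of_nat_power)+
  have n0: "real n > 0" using rn(1) by (rule less_le_trans[rotated]) simp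
  have k2: "real k \<ge> 2" using k by simp
  have "ln ((2::real) ^ k) \<le> ln (real n)" using rn(1) n0 by (intro ln_mono) auto
  then have lo: "real k * ln 2 \<le> ln (real n)" by (simp add: ln_realpow)
  have "ln (real n) \<le> ln ((2::real) ^ (k + 1))" using rn(2) n0 by (intro ln_mono) auto
  then have hi: "ln (real n) \<le> real (k + 1) * ln 2" by (simp only: ln_realpow)
  have "real k * (2 / 3) \<le> real k * ln 2" using ln2_ge_two_thirds by (intro mult_left_mono) auto
  then have lo': "real k * 2 / 3 \<le> ln (real n)" using lo by simp
  have "real (k + 1) * ln 2 \<le> real (k + 1) * 1" using ln_2_less_1 by (intro mult_left_mono) auto
  also have "\<dots> \<le> 2 * real k" using k2 by simp
  also have "\<dots> \<le> real k * real k" using k2 by (intro mult_right_mono) auto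
  finally have hi': "ln (real n) \<le> real k ^ 2" using hi by (simp add: power2_eq_square)
  have pos: "ln (real n) > 0" using lo' k2 by simp
  have "ln (ln (real n)) \<le> ln (real k ^ 2)" using hi' pos by (intro ln_mono) auto
  then show "ln (ln (real n)) \<le> 2 * ln (real k)" using k2 by (simp add: ln_realpow)
  have "8 \<le> real k ^ 3" using power_mono[OF k2, of 3] by simp
  then have "real k * 1 \<le> real k * (real k ^ 3 * 16 / 81)" using k2 by (intro mult_left_mono) auto
  also have "\<dots> = (real k * 2 / 3) ^ 4" by (simp add: power_divide power_mult_distrib eval_nat_numeral)
  also have "\<dots> \<le> ln (real n) ^ 4" using lo' by (intro power_mono) auto
  finally have "ln (real k) \<le> ln (ln (real n) ^ 4)" using k2 by (intro ln_mono) auto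
  then show "ln (real k) / 4 \<le> ln (ln (real n))" using pos by (simp add: ln_realpow)
qed

definition gap_term :: "real \<Rightarrow> nat \<Rightarrow> real" where
  "gap_term c n = 1 / (real (prime_gap n) * real n * ln (ln (real n)) powr c)"

lemma gap_term_nonneg: "gap_term c n \<ge> 0"
  by (simp add: gap_term_def)

text \<open>
  On the block, \<open>n\<close> may be replaced by \<open>2 ^ k\<close> and \<open>ln (ln n)\<close> by \<open>ln k\<close> at the cost of constants; the
  average bound with \<open>M = 2 ^ (k + 1)\<close> supplies the factor \<open>2 ^ k * ln k / k\<close>.
\<close>

lemma dyadic_block_le:
  assumes k: "k \<ge> 2"
  shows "(\<Sum>n=2^k..<2^(k+1). gap_term c n) \<le>
    2400000 * 4 powr \<bar>c\<bar> * (ln (real k) powr (1 - c) / real k)"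
proof -
  define w where "w = 4 powr \<bar>c\<bar> * ln (real k) powr (- c)"
  have k2: "real k \<ge> 2" using k by simp
  have "ln 2 \<le> ln (real k)" using k2 by simp
  then have lk: "ln (real k) \<ge> 2 / 3" using ln2_ge_two_thirds by linarith
  have w0: "w \<ge> 0" by (simp add: w_def)
  have four: "(4::nat) \<le> 2 ^ k" using power_increasing[OF k, of "2::nat"] by simp
  have term_le: "gap_term c n \<le> w / 2 ^ k * (1 / real (prime_gap n))" if n: "n \<in> {2^k..<2^(k+1)}" for n
  proof -
    have ll: "ln (real k) / 4 \<le> ln (ln (real n))" "ln (ln (real n)) \<le> 2 * ln (real k)"
      using ln_ln_dyadic[OF k, of n] n by auto
    have "ln (ln (real n)) powr (- c) \<le> 4 powr \<bar>- c\<bar> * ln (real k) powr (- c)"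
      using ll lk by (intro powr_comparable) auto
    then have 1: "ln (ln (real n)) powr (- c) \<le> w" by (simp add: w_def)
    have "real (2 ^ k) \<le> real n" using n by (simp only: of_nat_le_iff) simp
    then have 2: "1 / real n \<le> 1 / 2 ^ k" by (intro frac_le) auto
    have "gap_term c n = (1 / real (prime_gap n)) * (1 / real n) * ln (ln (real n)) powr (- c)"
      by (simp add: gap_term_def powr_minus divide_inverse)
    also have "\<dots> \<le> (1 / real (prime_gap n)) * (1 / 2 ^ k) * w"
      using 1 2 by (intro mult_mono) auto
    finally show ?thesis by (simp add: mult_ac)
  qed
  define M :: nat where "M = 2 ^ (k + 1)"
  have M: "M \<ge> 3" using four by (simp add: M_def)
  have "ln (real k) / 4 \<le> ln (ln (real M))" by (rule ln_ln_dyadic(1)[OF k]) (simp_all add: M_def)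
  then have lnln_M: "0 \<le> 1 + ln (ln (real M))" using lk by linarith
  have "(\<Sum>n=2^k..<2^(k+1). 1 / real (prime_gap n)) \<le> (\<Sum>n=1..M. 1 / real (prime_gap n))"
    using four by (intro sum_mono2) (auto simp: M_def)
  also have "\<dots> \<le> 200000 * (1 + ln (ln (real M))) * real M / ln (real M)"
    by (rule sum_recip_prime_gap_le[OF M])
  also have "\<dots> \<le> 200000 * (4 * ln (real k)) * (2 * 2 ^ k) / (real k * 2 / 3)"
  proof (intro frac_le mult_mono)
    show "1 + ln (ln (real M)) \<le> 4 * ln (real k)"
      using ln_ln_dyadic(2)[OF k, of M] lk by (simp add: M_def)
    have "ln (real M) = real (k + 1) * ln 2"
      unfolding M_def of_nat_power of_nat_numeral by (rule ln_realpow)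
    moreover have "real (k + 1) * (2 / 3) \<le> real (k + 1) * ln 2" 
      using ln2_ge_two_thirds by (intro mult_left_mono) auto
    ultimately show "real k * 2 / 3 \<le> ln (real M)" by simp
  qed (use k2 lk lnln_M in \<open>auto simp: M_def\<close>)
  finally have recip: "(\<Sum>n=2^k..<2^(k+1). 1 / real (prime_gap n)) \<le>
      200000 * (4 * ln (real k)) * (2 * 2 ^ k) / (real k * 2 / 3)" .
  have "(\<Sum>n=2^k..<2^(k+1). gap_term c n) \<le> (\<Sum>n=2^k..<2^(k+1). w / 2 ^ k * (1 / real (prime_gap n)))"
    by (intro sum_mono term_le)
  also have "\<dots> = w / 2 ^ k * (\<Sum>n=2^k..<2^(k+1). 1 / real (prime_gap n))"
    by (simp only: sum_distrib_left)
  also have "\<dots> \<le> w / 2 ^ k * (200000 * (4 * ln (real k)) * (2 * 2 ^ k) / (real k * 2 / 3))"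
    using w0 by (intro mult_left_mono recip) auto
  also have "\<dots> = 2400000 * 4 powr \<bar>c\<bar> * (ln (real k) powr (- c) * ln (real k) / real k)"
    using k2 by (simp add: w_def field_simps)
  also have "ln (real k) powr (- c) * ln (real k) = ln (real k) powr (- c) * ln (real k) powr 1"
    using lk by simp
  also have "\<dots> = ln (real k) powr (1 - c)" by (simp only: powr_add[symmetric]) simp
  finally show ?thesis .
qed

section \<open>Comparison with the antiderivative\<close>

definition log_power_integral :: "real \<Rightarrow> real \<Rightarrow> real" where
  "log_power_integral c x = (if c = 2 then ln (ln x) else ln x powr (2 - c) / (2 - c))"

lemma log_power_integral_deriv:
  assumes "x > 1"
  shows "(log_power_integral c has_real_derivative ln x powr (1 - c) / x) (at x)"
proof -
  have lx: "ln x > 0" using assms by simp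
  show ?thesis
  proof (cases "c = 2")
    case True
    have "((\<lambda>x. ln (ln x)) has_real_derivative ln x powr (1 - c) / x) (at x)"
      using assms lx True by (auto intro!: derivative_eq_intros simp: powr_minus field_simps)
    then show ?thesis by (simp add: log_power_integral_def[abs_def] True)
  next
    case False
    have "((\<lambda>x. ln x powr (2 - c) / (2 - c)) has_real_derivative ln x powr (1 - c) / x) (at x)"
    proof -
      have "((\<lambda>x. ln x powr (2 - c)) has_real_derivative (2 - c) * ln x powr (2 - c - 1) * (1 / x)) (at x)"
        by (rule DERIV_chain2[OF has_real_derivative_powr DERIV_ln_divide]) (use assms lx in auto)
      from DERIV_cdivide[OF this, of "2 - c"] show ?thesis using False by simp
    qed
    then show ?thesis using False by (simp add: log_power_integral_def[abs_def])
  qed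
qed

lemma log_power_integral_mono:
  assumes "1 < x" "x \<le> y"
  shows "log_power_integral c x \<le> log_power_integral c y"
proof (rule DERIV_nonneg_imp_nondecreasing[OF assms(2)])
  fix t assume "x \<le> t" "t \<le> y"
  then show "\<exists>d. (log_power_integral c has_real_derivative d) (at t) \<and> 0 \<le> d"
    using assms by (intro exI[of _ "ln t powr (1 - c) / t"] conjI log_power_integral_deriv) auto
qed

text \<open>
  By the mean value theorem the increment is \<open>(ln z) powr (1 - c) / z\<close> for some \<open>z\<close> between \<open>k\<close> and
  \<open>k + 1\<close>.  Comparing orders of magnitude at \<open>z\<close> and \<open>k\<close>, rather than using monotonicity, covers all
  \<open>c\<close> at once; the integrand is not monotone when \<open>c < 1\<close>.
\<close>

lemma log_power_le_integral_step:
  assumes k: "k \<ge> (2::nat)"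
  shows "ln (real k) powr (1 - c) / real k \<le> 
    2 * 2 powr \<bar>1 - c\<bar> * (log_power_integral c (real (k + 1)) - log_power_integral c (real k))"
proof -
  have "\<exists>z>real k. z < real (k + 1) \<and> log_power_integral c (real (k + 1)) - log_power_integral c (real k) =
      (real (k + 1) - real k) * (ln z powr (1 - c) / z)"
    using k by (intro MVT2 log_power_integral_deriv) auto
  then obtain z where z: "real k < z" "z < real (k + 1)"
    and eq: "log_power_integral c (real (k + 1)) - log_power_integral c (real k) = ln z powr (1 - c) / z"
    by auto
  have k2: "real k \<ge> 2" using k by simp
  have zk: "z \<le> 2 * real k" using z k2 by simp
  have "2 * real k \<le> real k * real k" using k2 by (intro mult_right_mono) auto
  then have "z \<le> real k * real k" using zk by linarith
  moreover have "z > 0" using z k2 by linarith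
  ultimately have "ln z \<le> ln (real k * real k)" by (intro ln_mono) auto
  then have lz: "ln z \<le> 2 * ln (real k)" using k2 by (simp add: ln_mult)
  have "ln (real k) powr (1 - c) \<le> 2 powr \<bar>1 - c\<bar> * ln z powr (1 - c)"
  proof (rule powr_comparable)
    have "ln (real k) \<le> ln z" using z k2 by simp
    moreover have "ln z > 0" using z k2 by simp
    ultimately show "ln (real k) \<le> 2 * ln z" by simp
  qed (use z k2 lz in auto)
  then have "ln (real k) powr (1 - c) * (1 / real k) \<le> 2 powr \<bar>1 - c\<bar> * ln z powr (1 - c) * (2 / z)"
    using zk z k2 by (intro mult_mono) (auto simp: field_simps)
  then show ?thesis unfolding eq by (simp add: mult_ac)
qed

lemma sum_gap_term_dyadic_le:
  "\<exists>C\<ge>0. \<forall>K\<ge>1. (\<Sum>n=4..<2^(K+1). gap_term c n) \<le> 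
     C * (log_power_integral c (real (K + 1)) - log_power_integral c 2)"
proof -
  define C where "C = 2400000 * 4 powr \<bar>c\<bar> * (2 * 2 powr \<bar>1 - c\<bar>)"
  have "(\<Sum>n=4..<2^(K+1). gap_term c n) \<le> C * (log_power_integral c (real (K + 1)) - log_power_integral c 2)"
    if "K \<ge> 1" for K
    using that
  proof (induction K rule: dec_induct)
    case base
    show ?case by simp
  next
    case (step K)
    define k where "k = K + 1"
    have k: "k \<ge> 2" using step by (simp add: k_def)
    have "(4::nat) \<le> 2 ^ k" using power_increasing[OF k, of "2::nat"] by simp
    then have "(\<Sum>n=4..<2^(k+1). gap_term c n) = (\<Sum>n=4..<2^k. gap_term c n) + (\<Sum>n=2^k..<2^(k+1). gap_term c n)"
      by (intro sum.atLeastLessThan_concat[symmetric]) auto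
    moreover have "(\<Sum>n=2^k..<2^(k+1). gap_term c n) \<le> 2400000 * 4 powr \<bar>c\<bar> * (ln (real k) powr (1 - c) / real k)"
      by (rule dyadic_block_le[OF k])
    moreover have "2400000 * 4 powr \<bar>c\<bar> * (ln (real k) powr (1 - c) / real k) \<le>
        2400000 * 4 powr \<bar>c\<bar> * (2 * 2 powr \<bar>1 - c\<bar> * (log_power_integral c (real (k + 1)) - log_power_integral c (real k)))"
      by (intro mult_left_mono log_power_le_integral_step[OF k]) auto
    moreover have "\<dots> = C * (log_power_integral c (real (k + 1)) - log_power_integral c (real k))"
      by (simp add: C_def)
    moreover have "(\<Sum>n=4..<2^k. gap_term c n) \<le> C * (log_power_integral c (real k) - log_power_integral c 2)"
      using step.IH by (simp add: k_def)
    ultimately have "(\<Sum>n=4..<2^(k+1). gap_term c n) \<le> C * (log_power_integral c (real (k + 1)) - log_power_integral c 2)"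
      by (simp add: algebra_simps)
    then show ?case by (simp add: k_def)
  qed
  moreover have "C \<ge> 0" by (simp add: C_def)
  ultimately show ?thesis by blast
qed

lemma gap_sum_eq:
  assumes "X \<ge> 0"
  shows "gap_sum c X = (\<Sum>n=3..nat \<lfloor>X\<rfloor>. gap_term c n)"
  unfolding gap_sum_def gap_term_def
  by (rule sum.cong) (use assms in \<open>auto simp: le_nat_iff le_floor_iff\<close>)

text \<open>
  The sum up to \<open>X\<close> is covered by the single term \<open>n = 3\<close> and the blocks \<open>k = 2, \<dots>, \<lfloor>log 2 X\<rfloor>\<close>.
\<close>

lemma gap_sum_bounds:
  "\<exists>C B. C \<ge> 0 \<and> (\<forall>X\<ge>4. 0 \<le> gap_sum c X \<and> gap_sum c X \<le> B + C * log_power_integral c (log 2 X + 1))"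
proof -
  obtain C where C: "C \<ge> 0" and le: "\<And>K. K \<ge> 1 \<Longrightarrow> (\<Sum>n=4..<2^(K+1). gap_term c n) \<le> 
     C * (log_power_integral c (real (K + 1)) - log_power_integral c 2)"
    using sum_gap_term_dyadic_le by blast
  define B where "B = gap_term c 3 - C * log_power_integral c 2"
  have "0 \<le> gap_sum c X \<and> gap_sum c X \<le> B + C * log_power_integral c (log 2 X + 1)" if X: "X \<ge> 4" for X
  proof
    have eq: "gap_sum c X = (\<Sum>n=3..nat \<lfloor>X\<rfloor>. gap_term c n)" using X by (intro gap_sum_eq) auto
    show "0 \<le> gap_sum c X" unfolding eq by (intro sum_nonneg gap_term_nonneg)
    define K where "K = nat \<lfloor>log 2 X\<rfloor>"
    have "log 2 X \<ge> 1" using X by (subst le_log_iff) auto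
    then have K: "K \<ge> 1" "real K \<le> log 2 X" "log 2 X < real (K + 1)"
      unfolding K_def by (auto simp: le_nat_iff le_floor_iff) linarith+
    have "X = 2 powr (log 2 X)" using X by simp
    also have "\<dots> < 2 powr real (K + 1)" using K(3) by (intro powr_less_mono) auto
    also have "\<dots> = 2 ^ (K + 1)" by (rule powr_realpow) simp
    finally have XK: "X < 2 ^ (K + 1)" .
    have "{3..nat \<lfloor>X\<rfloor>} \<subseteq> insert 3 {4..<2^(K+1)}"
    proof
      fix n assume n: "n \<in> {3..nat \<lfloor>X\<rfloor>}"
      then have "real n \<le> X" using X by (auto simp: le_nat_iff le_floor_iff)
      then have "real n < real (2 ^ (K + 1))" using XK by simp
      then have "n < 2 ^ (K + 1)" by (simp only: of_nat_less_iff)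
      then show "n \<in> insert 3 {4..<2^(K+1)}" using n by auto
    qed
    then have "gap_sum c X \<le> (\<Sum>n\<in>insert 3 {4..<2^(K+1)}. gap_term c n)"
      unfolding eq by (intro sum_mono2 gap_term_nonneg) auto
    also have "\<dots> = gap_term c 3 + (\<Sum>n=4..<2^(K+1). gap_term c n)" by (subst sum.insert) auto
    also have "\<dots> \<le> gap_term c 3 + C * (log_power_integral c (real (K + 1)) - log_power_integral c 2)"
      by (intro add_left_mono le K)
    also have "\<dots> \<le> gap_term c 3 + C * (log_power_integral c (log 2 X + 1) - log_power_integral c 2)"
      using K C by (intro add_left_mono mult_left_mono diff_right_mono log_power_integral_mono) auto
    finally show "gap_sum c X \<le> B + C * log_power_integral c (log 2 X + 1)"
      by (simp add: B_def algebra_simps)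
  qed
  then show ?thesis using C by blast
qed


section \<open>The three ranges of the exponent\<close>

text \<open>
  For \<open>c > 2\<close> the antiderivative is nowhere positive, so the partial sums of this series of
  nonnegative terms are bounded.
\<close>

lemma tendsto_gap_sum:
  assumes "c > 2"
  shows "\<exists>\<gamma>. (gap_sum c \<longlongrightarrow> \<gamma>) at_top"
proof -
  obtain C B where C: "C \<ge> 0" and le: "\<And>X. X \<ge> 4 \<Longrightarrow> gap_sum c X \<le> B + C * log_power_integral c (log 2 X + 1)"
    using gap_sum_bounds[of c] by blast
  have neg: "log_power_integral c x \<le> 0" for x
    using assms by (simp add: log_power_integral_def divide_nonneg_neg)
  define f where "f n = (if n \<ge> 3 then gap_term c n else 0)" for n
  have gap_sum_f: "gap_sum c X = (\<Sum>n<Suc (nat \<lfloor>X\<rfloor>). f n)" if "X \<ge> 0" for X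
  proof -
    have "(\<Sum>n=3..nat \<lfloor>X\<rfloor>. gap_term c n) = (\<Sum>n<Suc (nat \<lfloor>X\<rfloor>). f n)"
      by (rule sum.mono_neutral_cong_left) (auto simp: f_def)
    then show ?thesis using gap_sum_eq[OF that] by simp
  qed
  have f_nonneg: "f n \<ge> 0" for n by (simp add: f_def gap_term_nonneg)
  have "summable f"
  proof (rule summableI_nonneg_bounded[OF f_nonneg])
    fix N
    have "(\<Sum>n<N. f n) \<le> (\<Sum>n<Suc (nat \<lfloor>real (N + 4)\<rfloor>). f n)"
      by (intro sum_mono2 f_nonneg) auto
    also have "\<dots> = gap_sum c (real (N + 4))" by (rule gap_sum_f[symmetric]) simp
    also have "\<dots> \<le> B + C * log_power_integral c (log 2 (real (N + 4)) + 1)" by (rule le) simp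
    also have "\<dots> \<le> B + C * 0" by (intro add_left_mono mult_left_mono neg C)
    finally show "(\<Sum>n<N. f n) \<le> B" by simp
  qed
  then have lim: "(\<lambda>N. \<Sum>n<N. f n) \<longlonglongrightarrow> suminf f" by (rule summable_LIMSEQ)
  have "filterlim (\<lambda>X::real. Suc (nat \<lfloor>X\<rfloor>)) sequentially at_top"
    by (intro filterlim_compose[OF filterlim_Suc] filterlim_compose[OF filterlim_nat_sequentially] filterlim_floor_sequentially)
  from filterlim_compose[OF lim this]
  have "((\<lambda>X::real. \<Sum>n<Suc (nat \<lfloor>X\<rfloor>). f n) \<longlongrightarrow> suminf f) at_top" .
  moreover have "\<forall>\<^sub>F X::real in at_top. (\<Sum>n<Suc (nat \<lfloor>X\<rfloor>). f n) = gap_sum c X"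
    using eventually_ge_at_top[of 0] by eventually_elim (simp add: gap_sum_f del: sum.lessThan_Suc)
  ultimately have "(gap_sum c \<longlongrightarrow> suminf f) at_top" by (rule Lim_transform_eventually)
  then show ?thesis by blast
qed

lemma gap_sum_bigo:
  assumes "(\<lambda>_. 1) \<in> O(g)" "(\<lambda>X. log_power_integral c (log 2 X + 1)) \<in> O(g)"
  shows "gap_sum c \<in> O(g)"
proof -
  obtain C B where "\<And>X. X \<ge> 4 \<Longrightarrow> 0 \<le> gap_sum c X \<and> gap_sum c X \<le> B + C * log_power_integral c (log 2 X + 1)"
    using gap_sum_bounds[of c] by blast
  then have "gap_sum c \<in> O(\<lambda>X. B + C * log_power_integral c (log 2 X + 1))"
    by (intro bigoI[of _ 1] eventually_mono[OF eventually_ge_at_top[of 4]]) fastforce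
  also have "(\<lambda>X. B + C * log_power_integral c (log 2 X + 1)) \<in> O(g)"
  proof (rule sum_in_bigo)
    show "(\<lambda>X. B) \<in> O(g)" using landau_o.big_trans[OF _ assms(1), of "\<lambda>_. B"] by simp
    show "(\<lambda>X. C * log_power_integral c (log 2 X + 1)) \<in> O(g)"
      using assms(2) by (cases "C = 0") simp_all
  qed
  finally show ?thesis .
qed

theorem corollary1p4:
  fixes c :: real
  shows "(c > 2 \<longrightarrow> (\<exists>\<gamma>::real. (\<lambda>X. gap_sum c X - \<gamma>) \<in> o[at_top](\<lambda>_. 1))) \<and>
         (c = 2 \<longrightarrow> gap_sum c \<in> O[at_top](\<lambda>X. ln (ln (ln X)))) \<and>
         (c < 2 \<longrightarrow> gap_sum c \<in> O[at_top](\<lambda>X. ln (ln X) powr (2 - c) / (2 - c)))"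
proof (intro conjI impI)
  assume "c > 2"
  then obtain \<gamma> where "(gap_sum c \<longlongrightarrow> \<gamma>) at_top" using tendsto_gap_sum by blast
  then have "((\<lambda>X. gap_sum c X - \<gamma>) \<longlongrightarrow> 0) at_top" by (simp add: LIM_zero)
  then have "(\<lambda>X. gap_sum c X - \<gamma>) \<in> o[at_top](\<lambda>_. 1)" by (intro smalloI_tendsto) auto
  then show "\<exists>\<gamma>::real. (\<lambda>X. gap_sum c X - \<gamma>) \<in> o[at_top](\<lambda>_. 1)" ..
next
  assume c: "c = 2"
  show "gap_sum c \<in> O[at_top](\<lambda>X. ln (ln (ln X)))"
  proof (rule gap_sum_bigo)
    show "(\<lambda>_. 1) \<in> O(\<lambda>X::real. ln (ln (ln X)))" by real_asymp
    show "(\<lambda>X. log_power_integral c (log 2 X + 1)) \<in> O(\<lambda>X. ln (ln (ln X)))"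
      unfolding log_power_integral_def c log_def by simp real_asymp
  qed
next
  assume c: "c < 2"
  define e where "e = 2 - c"
  have e: "e > 0" using c by (simp add: e_def)
  show "gap_sum c \<in> O[at_top](\<lambda>X. ln (ln X) powr (2 - c) / (2 - c))"
  proof (rule gap_sum_bigo)
    show "(\<lambda>_. 1) \<in> O(\<lambda>X::real. ln (ln X) powr (2 - c) / (2 - c))"
      unfolding e_def[symmetric] using e by real_asymp
    have "(\<lambda>X::real. ln (ln X / ln 2 + 1) powr e / e) \<in> O(\<lambda>X. ln (ln X) powr e / e)"
      using e by real_asymp
    then show "(\<lambda>X. log_power_integral c (log 2 X + 1)) \<in> O(\<lambda>X. ln (ln X) powr (2 - c) / (2 - c))"
      unfolding log_power_integral_def e_def log_def using c by simp
  qed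
qed

end
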